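(* Every $\mathit{LTL}^{\Box\bigcirc}_{\mathit{core}}$ ontology-mediated positive instance query (OMPIQ) is $\mathrm{FO}(<,\equiv)$-rewritable, and every $\mathit{LTL}^{\Box}_{\mathit{horn}}$ OMPIQ is $\mathrm{FO}(<)$-rewritable.
   Context: Fix a countably infinite set of atomic concepts. Positive temporal concepts are given by $\varkappa::=\top\mid A_i\mid\varkappa_1\land\varkappa_2\mid\varkappa_1\lor\varkappa_2\mid\bigcirc_F\varkappa\mid\Diamond_F\varkappa\mid\Box_F\varkappa\mid\varkappa_1\,\mathcal U\,\varkappa_2\mid\bigcirc_P\varkappa\mid\Diamond_P\varkappa\mid\Box_P\varkappa\mid\varkappa_1\,\mathcal S\,\varkappa_2$. An interpretation $\mathfrak M$ assigns to each atomic concept $A$ a set $A^{\mathfrak M}\subseteq\mathbb Z$. Extensions: $\top^{\mathfrak M}=\mathbb Z$, $\land,\lor$ are $\cap,\cup$, $(\bigcirc_F\varkappa)^{\mathfrak M}=\{n\mid n+1\in\varkappa^{\mathfrak M}\}$, $(\Box_F\varkappa)^{\mathfrak M}=\{n\mid k\in\varkappa^{\mathfrak M}\ \forall k>n\}$, $(\Diamond_F\varkappa)^{\mathfrak M}=\{n\mid\exists k>n,\ k\in\varkappa^{\mathfrak M}\}$, $(\varkappa_1\,\mathcal U\,\varkappa_2)^{\mathfrak M}=\{n\mid\exists k>n,\ k\in\varkappa_2^{\mathfrak M}\text{ and }m\in\varkappa_1^{\mathfrak M}\text{ for all }n<m<k\}$, and symmetrically for the past operators. An ontology $\mathcal O$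 is a finite set of clauses $C_1\land\dots\land C_k\to C_{k+1}\lor\dots\lor C_{k+m}$, $k,m\ge0$ (empty $\land$ is $\top$, empty $\lor$ is $\bot$), where each $C_i$ is an atomic concept prefixed by a sequence of operators from $\Box_F,\Box_P,\bigcirc_F,\bigcirc_P$. It is an $\mathit{LTL}^{\Box\bigcirc}_{\mathit{core}}$ ontology if every clause satisfies $k+m\le2$ and $m\le1$; it is an $\mathit{LTL}^{\Box}_{\mathit{horn}}$ ontology if every clause satisfies $m\le1$ and only the operators $\Box_F,\Box_P$ occur in it. A clause is true in $\mathfrak M$ if $\bigcap_{i\le k}C_i^{\mathfrak M}\subseteq\bigcup_{j=1}^{m}C_{k+j}^{\mathfrak M}$ (empty $\bigcap$ is $\mathbb Z$, empty $\bigcup$ is $\emptyset$). An $\mathit{LTL}^{\boldsymbol o}_{\boldsymbol c}$ OMPIQ is a pair $\boldsymbol q=(\mathcal O,\varkappa)$ with an $\mathit{LTL}^{\boldsymbol o}_{\boldsymbol c}$ ontology $\mathcal O$ and a positive temporal concept $\varkappa$ (which may use all temporal operators above). A data instance $\mathcal A$ is a finite set of ground atoms $A_i(\ell)$, $\ell\in\mathbb Z$; it is assumed throughout that the least integer $\min\mathcal A$ occurring in it is $0$ and the greatest one satisfies $\max\mathcal A\ge1$; $\mathrm{tem}(\mathcal A)=\{n\in\mathbb Z\mid\min\mathcal A\le n\le\max\mathcal A\}$. $\mathfrak M$ is a model of $(\mathcal O,\mathcal A)$ if all clauses of $\mathcal O$ are true in $\mathfrak M$ and $\ell\in A^{\mathfrak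 M}$ for all $A(\ell)\in\mathcal A$. $\mathrm{ans}(\boldsymbol q,\mathcal A)=\{\ell\in\mathrm{tem}(\mathcal A)\mid\ell\in\varkappa^{\mathfrak M}\text{ for every model }\mathfrak M\text{ of }(\mathcal O,\mathcal A)\}$. $\mathfrak S_{\mathcal A}$ is the finite first-order structure with domain $\mathrm{tem}(\mathcal A)$ ordered by $<$ in which $A(\ell)$ holds iff $A(\ell)\in\mathcal A$. For a class $\mathcal L$ of formulas, $\boldsymbol q$ is $\mathcal L$-rewritable if there is a constant-free $\mathcal L$-formula $\boldsymbol Q(t)$ with one free variable such that $\mathrm{ans}(\boldsymbol q,\mathcal A)=\{\ell\in\mathrm{tem}(\mathcal A)\mid\mathfrak S_{\mathcal A}\models\boldsymbol Q(\ell)\}$ for every data instance $\mathcal A$. $\mathrm{FO}(<)$ is first-order logic over the unary predicates for atomic concepts and $<$; $\mathrm{FO}(<,\equiv)$ additionally has unary predicates $t\equiv0\pmod n$, for each fixed $n>1$, true of $\ell$ iff $n$ divides $\ell$. *)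

theory Defs
  imports Main
begin

text \<open>Atomic concepts are named by natural numbers, so there are countably infinitely many.\<close>

type_synonym atom = nat

type_synonym interp = "atom \<Rightarrow> int set"

text \<open>All operators are strict: the present moment is excluded.\<close>

definition next_F :: "int set \<Rightarrow> int set" where
  "next_F X = {n. n + 1 \<in> X}"

definition next_P :: "int set \<Rightarrow> int set" where
  "next_P X = {n. n - 1 \<in> X}"

definition box_F :: "int set \<Rightarrow> int set" where
  "box_F X = {n. \<forall>k>n. k \<in> X}"

definition box_P :: "int set \<Rightarrow> int set" where
  "box_P X = {n. \<forall>k<n. k \<in> X}"

definition dia_F :: "int set \<Rightarrow> int set" where
  "dia_F X = {n. \<exists>k>n. k \<in> X}"

definition dia_P :: "int set \<Rightarrow> int set" where
  "dia_P X = {n. \<exists>k<n. k \<in> X}"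

definition until :: "int set \<Rightarrow> int set \<Rightarrow> int set" where
  "until X Y = {n. \<exists>k>n. k \<in> Y \<and> (\<forall>m. n < m \<and> m < k \<longrightarrow> m \<in> X)}"

definition since :: "int set \<Rightarrow> int set \<Rightarrow> int set" where
  "since X Y = {n. \<exists>k<n. k \<in> Y \<and> (\<forall>m. k < m \<and> m < n \<longrightarrow> m \<in> X)}"

datatype pconcept =
    PTop
  | PAtom atom
  | PAnd pconcept pconcept
  | POr pconcept pconcept
  | PNextF pconcept
  | PDiaF pconcept
  | PBoxF pconcept
  | PUntil pconcept pconcept
  | PNextP pconcept
  | PDiaP pconcept
  | PBoxP pconcept
  | PSince pconcept pconcept

primrec pext :: "interp \<Rightarrow> pconcept \<Rightarrow> int set" where
  "pext M PTop = UNIV"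
| "pext M (PAtom a) = M a"
| "pext M (PAnd c d) = pext M c \<inter> pext M d"
| "pext M (POr c d) = pext M c \<union> pext M d"
| "pext M (PNextF c) = next_F (pext M c)"
| "pext M (PDiaF c) = dia_F (pext M c)"
| "pext M (PBoxF c) = box_F (pext M c)"
| "pext M (PUntil c d) = until (pext M c) (pext M d)"
| "pext M (PNextP c) = next_P (pext M c)"
| "pext M (PDiaP c) = dia_P (pext M c)"
| "pext M (PBoxP c) = box_P (pext M c)"
| "pext M (PSince c d) = since (pext M c) (pext M d)"

datatype tempop = BoxF | BoxP | NextF | NextP

primrec tempop_ext :: "tempop \<Rightarrow> int set \<Rightarrow> int set" where
  "tempop_ext BoxF = box_F"
| "tempop_ext BoxP = box_P"
| "tempop_ext NextF = next_F"
| "tempop_ext NextP = next_P"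

datatype tconcept = TAtom atom | TOp tempop tconcept

primrec tc_ext :: "interp \<Rightarrow> tconcept \<Rightarrow> int set" where
  "tc_ext M (TAtom a) = M a"
| "tc_ext M (TOp f C) = tempop_ext f (tc_ext M C)"

primrec tops :: "tconcept \<Rightarrow> tempop set" where
  "tops (TAtom a) = {}"
| "tops (TOp f C) = insert f (tops C)"

text \<open>\<open>Clause [C\<^sub>1, \<dots>, C\<^sub>k] [D\<^sub>1, \<dots>, D\<^sub>m]\<close> is the clause
  \<open>C\<^sub>1 \<and> \<dots> \<and> C\<^sub>k \<rightarrow> D\<^sub>1 \<or> \<dots> \<or> D\<^sub>m\<close>.\<close>

datatype clause = Clause (body: "tconcept list") (head: "tconcept list")

definition clause_true :: "interp \<Rightarrow> clause \<Rightarrow> bool" where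
  "clause_true M cl \<longleftrightarrow> (\<Inter>C\<in>set (body cl). tc_ext M C) \<subseteq> (\<Union>C\<in>set (head cl). tc_ext M C)"

definition clause_tops :: "clause \<Rightarrow> tempop set" where
  "clause_tops cl = (\<Union>C\<in>set (body cl) \<union> set (head cl). tops C)"

type_synonym ontology = "clause set"

definition ltl_box_next_core :: "ontology \<Rightarrow> bool" where
  "ltl_box_next_core Onto \<longleftrightarrow> finite Onto \<and>
     (\<forall>cl\<in>Onto. length (body cl) + length (head cl) \<le> 2 \<and> length (head cl) \<le> 1)"

definition ltl_box_horn :: "ontology \<Rightarrow> bool" where
  "ltl_box_horn Onto \<longleftrightarrow> finite Onto \<and>
     (\<forall>cl\<in>Onto. length (head cl) \<le> 1 \<and> clause_tops cl \<subseteq> {BoxF, BoxP})"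

text \<open>The pair \<open>(a, l)\<close> stands for the ground atom \<open>a(l)\<close>.\<close>

type_synonym data = "(atom \<times> int) set"

definition min_data :: "data \<Rightarrow> int" where
  "min_data A = Min (snd ` A)"

definition max_data :: "data \<Rightarrow> int" where
  "max_data A = Max (snd ` A)"

definition data_instance :: "data \<Rightarrow> bool" where
  "data_instance A \<longleftrightarrow> finite A \<and> A \<noteq> {} \<and> min_data A = 0 \<and> max_data A \<ge> 1"

definition tem :: "data \<Rightarrow> int set" where
  "tem A = {min_data A..max_data A}"

definition is_model :: "interp \<Rightarrow> ontology \<Rightarrow> data \<Rightarrow> bool" where
  "is_model M Onto A \<longleftrightarrow> (\<forall>cl\<in>Onto. clause_true M cl) \<and> (\<forall>(a, l)\<in>A. l \<in> M a)"

type_synonym ompiq = "ontology \<times> pconcept"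

definition ans :: "ompiq \<Rightarrow> data \<Rightarrow> int set" where
  "ans q A = {l \<in> tem A. \<forall>M. is_model M (fst q) A \<longrightarrow> l \<in> pext M (snd q)}"

text \<open>Variables are named by natural numbers. \<open>FCong n x\<close> is the atom
  \<open>x \<equiv> 0 (mod n)\<close>; the side condition on \<open>n\<close> is imposed in \<open>FO_less_cong\<close> below.\<close>

datatype fo =
    FPred atom nat
  | FLess nat nat
  | FEq nat nat
  | FCong nat nat
  | FNot fo
  | FAnd fo fo
  | FEx nat fo

primrec fv :: "fo \<Rightarrow> nat set" where
  "fv (FPred a x) = {x}"
| "fv (FLess x y) = {x, y}"
| "fv (FEq x y) = {x, y}"
| "fv (FCong n x) = {x}"
| "fv (FNot p) = fv p"
| "fv (FAnd p r) = fv p \<union> fv r"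
| "fv (FEx x p) = fv p - {x}"

primrec moduli :: "fo \<Rightarrow> nat set" where
  "moduli (FPred a x) = {}"
| "moduli (FLess x y) = {}"
| "moduli (FEq x y) = {}"
| "moduli (FCong n x) = {n}"
| "moduli (FNot p) = moduli p"
| "moduli (FAnd p r) = moduli p \<union> moduli r"
| "moduli (FEx x p) = moduli p"

definition FO_less :: "fo set" where
  "FO_less = {p. moduli p = {}}"

definition FO_less_cong :: "fo set" where
  "FO_less_cong = {p. \<forall>n\<in>moduli p. n > 1}"

primrec sat :: "int set \<Rightarrow> (atom \<Rightarrow> int set) \<Rightarrow> (nat \<Rightarrow> int) \<Rightarrow> fo \<Rightarrow> bool" where
  "sat D P v (FPred a x) \<longleftrightarrow> v x \<in> P a"
| "sat D P v (FLess x y) \<longleftrightarrow> v x < v y"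
| "sat D P v (FEq x y) \<longleftrightarrow> v x = v y"
| "sat D P v (FCong n x) \<longleftrightarrow> int n dvd v x"
| "sat D P v (FNot p) \<longleftrightarrow> \<not> sat D P v p"
| "sat D P v (FAnd p r) \<longleftrightarrow> sat D P v p \<and> sat D P v r"
| "sat D P v (FEx x p) \<longleftrightarrow> (\<exists>d\<in>D. sat D P (v(x := d)) p)"

definition data_sat :: "data \<Rightarrow> (nat \<Rightarrow> int) \<Rightarrow> fo \<Rightarrow> bool" where
  "data_sat A v p \<longleftrightarrow> sat (tem A) (\<lambda>a. {l. (a, l) \<in> A}) v p"

text \<open>As \<open>t\<close> is the only free variable of \<open>Q\<close>, the constant assignment \<open>\<lambda>_. l\<close> just evaluates
  \<open>Q\<close> at \<open>t = l\<close>.\<close>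

definition rewritable :: "fo set \<Rightarrow> ompiq \<Rightarrow> bool" where
  "rewritable L q \<longleftrightarrow> (\<exists>Q\<in>L. \<exists>t. fv Q = {t} \<and>
     (\<forall>A. data_instance A \<longrightarrow> ans q A = {l \<in> tem A. data_sat A (\<lambda>_. l) Q}))"

end

theory Submission
  imports Defs
begin

text \<open>For a concept \<open>C\<close> the extension of \<open>\<box>\<^sub>F C\<close> is empty, everything, or a ray, so the boxed concepts of
  a model are described by finitely many integer thresholds. Closing the data together with these
  rays under the clauses and next operators yields a submodel of the given model, hence \<open>l\<close> is a
  certain answer iff every threshold vector whose closure is a model puts \<open>l\<close> into the extension of
  the query. Given the thresholds, the closure involves no box introduction: for Horn ontologies
  without next it is computed pointwise, and for core ontologies it is reachability by walks with
  steps of size at most 1, whose possible lengths form ultimately periodic sets. Both are first-order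
  on the integer line (with congruences in the core case), and quantification over thresholds
  costs finitely many more quantifiers. First-order definability is handled semantically, as
  invariance under back-and-forth equivalence of some finite rank.\<close>

section \<open>Back-and-forth equivalence\<close>

text \<open>The obstacle is box introduction: a least model on the infinite line would have to add a
  boxed concept after infinitely many of its instances have been derived. Guessing the rays avoids
  this, and wrong guesses do no harm: a guess is consulted only if its closure is a model, and then
  the query has to hold in it anyway. The query passes from the submodel to the given model because
  it is positive, hence monotone. The fragments differ in how derivations spread. Without next
  operators a derivation stays at one point. With them, a clause with two premises would let it
  branch while moving; a core clause with a head has at most one premise, so a derivation is a
  single path and only its endpoints and total shift matter. Games suit the argument because
  thresholds range over all integers while formulas quantify over the finite data domain: a strategy
  on the domain extends to the line. Only finitely many formulas are needed to decide equivalence of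
  a fixed rank, so invariance yields a rewriting.\<close>

definition partial_iso :: "atom set \<Rightarrow> nat \<Rightarrow> data \<Rightarrow> data \<Rightarrow> (int \<times> int) set \<Rightarrow> bool" where
  "partial_iso \<Sigma> p A A' R \<longleftrightarrow>
     (\<forall>x x'. (x, x') \<in> R \<longrightarrow> (\<forall>a\<in>\<Sigma>. (a, x) \<in> A \<longleftrightarrow> (a, x') \<in> A') \<and> x mod int p = x' mod int p) \<and>
     (\<forall>x x' y y'. (x, x') \<in> R \<longrightarrow> (y, y') \<in> R \<longrightarrow> (x < y \<longleftrightarrow> x' < y'))"

text \<open>The Ehrenfeucht-Fraisse game from position \<open>R\<close> with \<open>k\<close> rounds
  left. \<open>R\<close> is tested only at the end, which loses nothing while moves exist, since
  partial isomorphisms restrict to subsets. In \<open>partial_iso\<close> the order clause also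
  takes care of equality, and \<open>p = 1\<close> makes the residue condition vacuous, which is the
  case of FO(<).\<close>

primrec back_forth ::
  "int set \<Rightarrow> int set \<Rightarrow> atom set \<Rightarrow> nat \<Rightarrow> data \<Rightarrow> data \<Rightarrow> nat \<Rightarrow> (int \<times> int) set \<Rightarrow> bool" where
  "back_forth D D' \<Sigma> p A A' 0 R \<longleftrightarrow> partial_iso \<Sigma> p A A' R"
| "back_forth D D' \<Sigma> p A A' (Suc k) R \<longleftrightarrow>
     (\<forall>d\<in>D. \<exists>d'\<in>D'. back_forth D D' \<Sigma> p A A' k (insert (d, d') R)) \<and>
     (\<forall>d'\<in>D'. \<exists>d\<in>D. back_forth D D' \<Sigma> p A A' k (insert (d, d') R))"

lemma partial_iso_subset: "partial_iso \<Sigma> p A A' R \<Longrightarrow> S \<subseteq> R \<Longrightarrow> partial_iso \<Sigma> p A A' S"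
  unfolding partial_iso_def by blast

lemma partial_iso_converse: "partial_iso \<Sigma> p A A' R \<Longrightarrow> partial_iso \<Sigma> p A' A (R\<inverse>)"
  unfolding partial_iso_def by simp

lemma back_forth_subset:
  "back_forth D D' \<Sigma> p A A' k R \<Longrightarrow> S \<subseteq> R \<Longrightarrow> back_forth D D' \<Sigma> p A A' k S"
proof (induction k arbitrary: R S)
  case 0
  then show ?case by (simp add: partial_iso_subset)
next
  case (Suc k)
  have ins: "insert z S \<subseteq> insert z R" for z using Suc.prems(2) by blast
  show ?case using Suc.prems(1) Suc.IH[OF _ ins] by simp blast
qed

lemma back_forth_converse:
  "back_forth D D' \<Sigma> p A A' k R \<Longrightarrow> back_forth D' D \<Sigma> p A' A k (R\<inverse>)"
proof (induction k arbitrary: R)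
  case 0
  then show ?case by (simp add: partial_iso_converse)
next
  case (Suc k)
  have "back_forth D' D \<Sigma> p A' A k (insert (d', d) (R\<inverse>))"
    if "back_forth D D' \<Sigma> p A A' k (insert (d, d') R)" for d d'
  proof -
    have "(insert (d, d') R)\<inverse> = insert (d', d) (R\<inverse>)" by auto
    then show ?thesis using Suc.IH[OF that] by simp
  qed
  then show ?case using Suc.prems by simp blast
qed

lemma back_forth_Suc:
  "D \<noteq> {} \<Longrightarrow> back_forth D D' \<Sigma> p A A' (Suc k) R \<Longrightarrow> back_forth D D' \<Sigma> p A A' k R"
proof (induction k arbitrary: R)
  case 0
  then obtain d where "d \<in> D" by blast
  then obtain d' where "partial_iso \<Sigma> p A A' (insert (d, d') R)" using 0 by auto
  then show ?case by (simp, blast intro: partial_iso_subset)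
next
  case (Suc k)
  then have IH: "back_forth D D' \<Sigma> p A A' (Suc k) S \<Longrightarrow> back_forth D D' \<Sigma> p A A' k S" for S by blast
  show ?case
    using Suc.prems(2) IH
    unfolding back_forth.simps(2)[of _ _ _ _ _ _ "Suc k"] back_forth.simps(2)[of _ _ _ _ _ _ k R] by blast
qed

lemma back_forth_mono:
  assumes "D \<noteq> {}" "back_forth D D' \<Sigma> p A A' k R" "j \<le> k"
  shows "back_forth D D' \<Sigma> p A A' j R"
  using assms(3,2)
  by (induction rule: dec_induct) (auto simp del: back_forth.simps intro: back_forth_Suc[OF assms(1)])

lemma back_forth_partial_iso:
  "D \<noteq> {} \<Longrightarrow> back_forth D D' \<Sigma> p A A' k R \<Longrightarrow> partial_iso \<Sigma> p A A' R"
  using back_forth_mono[of D D' \<Sigma> p A A' k R 0] by simp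

abbreviation "bfZ \<equiv> back_forth UNIV UNIV"

text \<open>Outside the data the two labelled lines look alike, so there the second player copies
  offsets.\<close>

lemma back_forth_extend:
  assumes A: "data_instance A" and A': "data_instance A'"
    and "back_forth (tem A) (tem A') \<Sigma> p A A' k R" "R \<subseteq> tem A \<times> tem A'"
    and "(0, 0) \<in> R" "(max_data A, max_data A') \<in> R"
  shows "bfZ \<Sigma> p A A' k (R \<union> {(-j, -j) |j. j > 0} \<union> {(max_data A + j, max_data A' + j) |j. j > 0})"
    (is "bfZ \<Sigma> p A A' k (?ext R)")
  using assms(3-)
proof (induction k arbitrary: R)
  case 0
  have R: "\<And>x x'. (x, x') \<in> R \<Longrightarrow> 0 \<le> x \<and> x \<le> max_data A \<and> 0 \<le> x' \<and> x' \<le> max_data A'"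
    using 0(2) A A' by (auto simp: tem_def data_instance_def)
  have out: "(a, x) \<notin> B" if "data_instance B" "x < 0 \<or> x > max_data B" for a x B
  proof
    assume "(a, x) \<in> B"
    then have x: "x \<in> snd ` B" by force
    moreover have "finite (snd ` B)" using that(1) by (simp add: data_instance_def)
    ultimately have "Min (snd ` B) \<le> x" "x \<le> Max (snd ` B)" by simp_all
    then show False using that unfolding data_instance_def min_data_def max_data_def by linarith
  qed
  have iso: "partial_iso \<Sigma> p A A' R" using 0(1) by simp
  \<comment> \<open>The right-hand tail is copied by offset from the maximum, so residues agree
    there because the two maxima are paired in \<open>R\<close>.\<close>
  have m: "max_data A mod int p = max_data A' mod int p"
    using iso 0(4) by (auto simp: partial_iso_def)
  have mpos: "max_data A \<ge> 1" "max_data A' \<ge> 1" using A A' by (auto simp: data_instance_def)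
  have *: "\<forall>x x'. (x, x') \<in> ?ext R \<longrightarrow> (\<forall>a\<in>\<Sigma>. (a, x) \<in> A \<longleftrightarrow> (a, x') \<in> A') \<and> x mod int p = x' mod int p"
  proof (intro allI impI, elim UnE)
    fix x x' :: int
    assume "(x, x') \<in> R"
    then show "(\<forall>a\<in>\<Sigma>. (a, x) \<in> A \<longleftrightarrow> (a, x') \<in> A') \<and> x mod int p = x' mod int p"
      using iso by (auto simp: partial_iso_def)
  next
    fix x x' :: int
    assume "(x, x') \<in> {(-j, -j) |j. j > 0}"
    then show "(\<forall>a\<in>\<Sigma>. (a, x) \<in> A \<longleftrightarrow> (a, x') \<in> A') \<and> x mod int p = x' mod int p"
      using out[OF A] out[OF A'] by auto
  next
    fix x x' :: int
    assume "(x, x') \<in> {(max_data A + j, max_data A' + j) |j. j > 0}"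
    then obtain j where "x = max_data A + j" "x' = max_data A' + j" "j > 0" by blast
    then show "(\<forall>a\<in>\<Sigma>. (a, x) \<in> A \<longleftrightarrow> (a, x') \<in> A') \<and> x mod int p = x' mod int p"
      using out[OF A, of x] out[OF A', of x'] mod_add_cong[OF m refl, of j] by auto
  qed
  have "\<forall>x x' y y'. (x, x') \<in> ?ext R \<longrightarrow> (y, y') \<in> ?ext R \<longrightarrow> (x < y \<longleftrightarrow> x' < y')"
  proof (intro allI impI, elim UnE)
    fix x x' y y' assume "(x, x') \<in> R" "(y, y') \<in> R"
    then show "x < y \<longleftrightarrow> x' < y'" using iso unfolding partial_iso_def by blast
  qed (use mpos in \<open>auto dest!: R\<close>)
  then show ?case unfolding back_forth.simps(1) partial_iso_def by (rule conjI[OF *])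
next
  case (Suc k)
  note hyp = Suc.prems
  have ne: "tem A \<noteq> {}" using A by (auto simp: tem_def data_instance_def)
  \<comment> \<open>A move outside the data is answered by a pair already present in the extended
    relation, so it leads back to this position.\<close>
  have base: "bfZ \<Sigma> p A A' k (?ext R)"
    using Suc.IH[OF back_forth_Suc[OF ne hyp(1)] hyp(2-)] .
  have 1: "bfZ \<Sigma> p A A' k (insert (d, d') (?ext R))"
    if "d \<in> tem A" "d' \<in> tem A'" "back_forth (tem A) (tem A') \<Sigma> p A A' k (insert (d, d') R)" for d d'
    using Suc.IH[OF that(3)] hyp that by simp
  have min: "min_data A = 0" "min_data A' = 0" using A A' by (auto simp: data_instance_def)
  have "\<exists>d'. bfZ \<Sigma> p A A' k (insert (d, d') (?ext R))" for d
  proof (cases "d \<in> tem A")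
    case True
    then obtain d' where "d' \<in> tem A'" "back_forth (tem A) (tem A') \<Sigma> p A A' k (insert (d, d') R)"
      using bspec[OF conjunct1[OF hyp(1)[unfolded back_forth.simps(2)]] True] by blast
    then show ?thesis using 1[OF True] by blast
  next
    case False
    then consider "d < 0" | "d > max_data A" by (auto simp: tem_def min)
    then obtain d' where "(d, d') \<in> ?ext R"
    proof cases
      case 1
      then have "(d, d) \<in> ?ext R" by (auto intro: exI[of _ "- d"])
      then show thesis by (rule that)
    next
      case 2
      then have "(d, max_data A' + (d - max_data A)) \<in> ?ext R" by (auto intro: exI[of _ "d - max_data A"])
      then show thesis by (rule that)
    qed
    then show ?thesis using base by (intro exI[of _ d']) (simp only: insert_absorb)
  qed
  moreover have "\<exists>d. bfZ \<Sigma> p A A' k (insert (d, d') (?ext R))" for d'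
  proof (cases "d' \<in> tem A'")
    case True
    then obtain d where "d \<in> tem A" "back_forth (tem A) (tem A') \<Sigma> p A A' k (insert (d, d') R)"
      using bspec[OF conjunct2[OF hyp(1)[unfolded back_forth.simps(2)]] True] by blast
    then show ?thesis using 1[OF _ True] by blast
  next
    case False
    then consider "d' < 0" | "d' > max_data A'" by (auto simp: tem_def min)
    then obtain d where "(d, d') \<in> ?ext R"
    proof cases
      case 1
      then have "(d', d') \<in> ?ext R" by (auto intro: exI[of _ "- d'"])
      then show thesis by (rule that)
    next
      case 2
      then have "(max_data A + (d' - max_data A'), d') \<in> ?ext R" by (auto intro: exI[of _ "d' - max_data A'"])
      then show thesis by (rule that)
    qed
    then show ?thesis using base by (intro exI[of _ d]) (simp only: insert_absorb)
  qed
  ultimately show ?case by simp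
qed

text \<open>Of the three extra rounds, the first plays 0, the second plays the maximum, and the
  third is a spare one that refutes any answer other than the corresponding endpoint.\<close>

lemma back_forth_endpoints:
  assumes A: "data_instance A" and A': "data_instance A'" and R: "R \<subseteq> tem A \<times> tem A'"
    and bf: "back_forth (tem A) (tem A') \<Sigma> p A A' (k + 3) R"
  shows "back_forth (tem A) (tem A') \<Sigma> p A A' k (insert (max_data A, max_data A') (insert (0, 0) R))"
proof -
  have t: "0 \<in> tem A" "0 \<in> tem A'" "max_data A \<in> tem A" "max_data A' \<in> tem A'"
    "tem A = {0..max_data A}" "tem A' = {0..max_data A'}"
    using A A' by (auto simp: tem_def data_instance_def)
  have ne: "tem A \<noteq> {}" using t by blast
  \<comment> \<open>The refutation: if \<open>d'\<close> is not the endpoint, playing the true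
    endpoint \<open>y'\<close> of the second domain demands a \<open>y\<close> beyond the endpoint
    \<open>d\<close> of the first.\<close>
  have match: "\<exists>y\<in>tem A. (y < d \<longleftrightarrow> y' < d') \<and> (d < y \<longleftrightarrow> d' < y')"
    if b: "back_forth (tem A) (tem A') \<Sigma> p A A' (Suc j) (insert (d, d') S)" and y': "y' \<in> tem A'" for d d' y' j S
  proof -
    obtain y where "y \<in> tem A" "back_forth (tem A) (tem A') \<Sigma> p A A' j (insert (y, y') (insert (d, d') S))"
      using bspec[OF conjunct2[OF b[unfolded back_forth.simps(2)]] y'] by blast
    then have "partial_iso \<Sigma> p A A' (insert (y, y') (insert (d, d') S))"
      using back_forth_partial_iso[OF ne] by blast
    then show ?thesis
      using \<open>y \<in> tem A\<close> unfolding partial_iso_def by (meson insertI1 insertI2)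
  qed
  have "\<exists>d'\<in>tem A'. back_forth (tem A) (tem A') \<Sigma> p A A' (Suc (Suc k)) (insert (0, d') R)"
    using bspec[OF conjunct1[OF bf[unfolded numeral_3_eq_3 add_Suc_right add_0_right back_forth.simps(2)[of _ _ _ _ _ _ "Suc (Suc k)"]]] t(1)] .
  then obtain z where z: "z \<in> tem A'" "back_forth (tem A) (tem A') \<Sigma> p A A' (Suc (Suc k)) (insert (0, z) R)"
    by blast
  have "z = 0" using match[OF z(2) t(2)] z(1) t(5,6) by auto
  have "\<exists>d'\<in>tem A'. back_forth (tem A) (tem A') \<Sigma> p A A' (Suc k) (insert (max_data A, d') (insert (0, 0) R))"
    using bspec[OF conjunct1[OF z(2)[unfolded \<open>z = 0\<close> back_forth.simps(2)[of _ _ _ _ _ _ "Suc k"]]] t(3)] .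
  then obtain m where m: "m \<in> tem A'"
    "back_forth (tem A) (tem A') \<Sigma> p A A' (Suc k) (insert (max_data A, m) (insert (0, 0) R))"
    by blast
  have "m = max_data A'" using match[OF m(2) t(4)] m(1) t(5,6) by auto
  then show ?thesis using back_forth_Suc[OF ne m(2)] by simp
qed

lemma back_forth_tem_to_bfZ:
  assumes "data_instance A" "data_instance A'" "x \<in> tem A" "x' \<in> tem A'"
    and "back_forth (tem A) (tem A') \<Sigma> p A A' (k + 3) {(x, x')}"
  shows "bfZ \<Sigma> p A A' k {(x, x')}"
proof -
  have t: "0 \<in> tem A" "0 \<in> tem A'" "max_data A \<in> tem A" "max_data A' \<in> tem A'"
    using assms(1,2) by (auto simp: tem_def data_instance_def)
  show ?thesis
    by (rule back_forth_subset[OF back_forth_extend[OF assms(1,2) back_forth_endpoints[OF assms(1,2) _ assms(5)]]])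
      (use assms(3,4) t in auto)
qed

section \<open>Formulas describing back-and-forth types\<close>

text \<open>Only divisibility is atomic, so residue \<open>r\<close> is expressed by descending
  \<open>r\<close> times to the immediate predecessor and testing divisibility there. The descent
  never falls off the domain when \<open>r < p\<close>: it starts at 0, and a nonnegative number
  with residue \<open>r\<close> is at least \<open>r\<close>.\<close>

primrec residue_fm :: "nat \<Rightarrow> nat \<Rightarrow> nat \<Rightarrow> fo" where
  "residue_fm p 0 i = FCong p i"
| "residue_fm p (Suc r) i =
     FEx (i + 1) (FAnd (FLess (i + 1) i)
       (FAnd (FNot (FEx (i + 2) (FAnd (FLess (i + 1) (i + 2)) (FLess (i + 2) i)))) (residue_fm p r (i + 1))))"

lemma fv_residue_fm: "fv (residue_fm p r i) = {i}"
  by (induction r arbitrary: i) auto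

lemma moduli_residue_fm: "moduli (residue_fm p r i) = {p}"
  by (induction r arbitrary: i) auto

lemma sat_residue_fm:
  "r < p \<Longrightarrow> v i \<in> {0..m} \<Longrightarrow> sat {0..m} P v (residue_fm p r i) \<longleftrightarrow> v i mod int p = int r"
proof (induction r arbitrary: i v)
  case 0
  then show ?case by (auto simp: dvd_eq_mod_eq_0)
next
  case (Suc r)
  have "sat {0..m} P v (residue_fm p (Suc r) i) \<longleftrightarrow>
    (\<exists>d\<in>{0..m}. d < v i \<and> \<not> (\<exists>e\<in>{0..m}. d < e \<and> e < v i) \<and> d mod int p = int r)"
  proof -
    have "sat {0..m} P (v(Suc i := d)) (residue_fm p r (Suc i)) \<longleftrightarrow> d mod int p = int r" if "d \<in> {0..m}" for d
      using Suc.IH[of "v(Suc i := d)" "Suc i"] Suc.prems(1) that by (simp only: fun_upd_same Suc_lessD)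
    then have "(\<exists>d\<in>{0..m}. C d \<and> sat {0..m} P (v(Suc i := d)) (residue_fm p r (Suc i))) \<longleftrightarrow>
      (\<exists>d\<in>{0..m}. C d \<and> d mod int p = int r)" for C
      by blast
    then show ?thesis by (simp flip: conj_assoc)
  qed
  also have "\<dots> \<longleftrightarrow> v i \<ge> 1 \<and> (v i - 1) mod int p = int r"
  proof
    assume "\<exists>d\<in>{0..m}. d < v i \<and> \<not> (\<exists>e\<in>{0..m}. d < e \<and> e < v i) \<and> d mod int p = int r"
    then obtain d where d: "d \<in> {0..m}" "d < v i" "\<not> (\<exists>e\<in>{0..m}. d < e \<and> e < v i)" "d mod int p = int r"
      by blast
    then have "\<not> d + 1 < v i" using Suc.prems(2) by force
    then have "d = v i - 1" using d(2) by simp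
    then show "v i \<ge> 1 \<and> (v i - 1) mod int p = int r" using d by auto
  next
    assume "v i \<ge> 1 \<and> (v i - 1) mod int p = int r"
    then show "\<exists>d\<in>{0..m}. d < v i \<and> \<not> (\<exists>e\<in>{0..m}. d < e \<and> e < v i) \<and> d mod int p = int r"
      using Suc.prems(2) by (intro bexI[of _ "v i - 1"]) auto
  qed
  also have "\<dots> \<longleftrightarrow> v i mod int p = int (Suc r)"
  proof
    assume *: "v i \<ge> 1 \<and> (v i - 1) mod int p = int r"
    have "v i mod int p = ((v i - 1) mod int p + 1) mod int p" by (simp add: mod_simps)
    also have "\<dots> = int (Suc r)" using * Suc.prems(1) by simp
    finally show "v i mod int p = int (Suc r)" .
  next
    assume *: "v i mod int p = int (Suc r)"
    have "v i \<noteq> 0" using * by auto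
    moreover have "(v i - 1) mod int p = (v i mod int p - 1) mod int p" by (simp add: mod_simps)
    moreover have "\<dots> = int r" using * Suc.prems(1) by simp
    ultimately show "v i \<ge> 1 \<and> (v i - 1) mod int p = int r" using Suc.prems(2) by auto
  qed
  finally show ?case .
qed

text \<open>\<open>FEq 0 0\<close> serves as truth. It makes variable 0 free in every conjunction
  and disjunction, so the final rewriting has exactly one free variable even if its disjunction is
  empty.\<close>

primrec conj_fm :: "fo list \<Rightarrow> fo" where
  "conj_fm [] = FEq 0 0"
| "conj_fm (f # fs) = FAnd f (conj_fm fs)"

definition disj_fm :: "fo list \<Rightarrow> fo" where
  "disj_fm fs = FNot (conj_fm (map FNot fs))"

definition sign_fm :: "fo set \<Rightarrow> fo \<Rightarrow> fo" where
  "sign_fm S f = (if f \<in> S then f else FNot f)"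

lemma sat_conj_fm [simp]: "sat D P v (conj_fm fs) \<longleftrightarrow> (\<forall>f\<in>set fs. sat D P v f)"
  by (induction fs) auto

lemma sat_disj_fm [simp]: "sat D P v (disj_fm fs) \<longleftrightarrow> (\<exists>f\<in>set fs. sat D P v f)"
  by (simp add: disj_fm_def)

lemma moduli_conj_fm [simp]: "moduli (conj_fm fs) = (\<Union>f\<in>set fs. moduli f)"
  by (induction fs) auto

lemma moduli_disj_fm [simp]: "moduli (disj_fm fs) = (\<Union>f\<in>set fs. moduli f)"
  by (simp add: disj_fm_def)

lemma fv_conj_fm [simp]: "fv (conj_fm fs) = insert 0 (\<Union>f\<in>set fs. fv f)"
  by (induction fs) auto

lemma fv_disj_fm [simp]: "fv (disj_fm fs) = insert 0 (\<Union>f\<in>set fs. fv f)"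
  by (simp add: disj_fm_def)

lemma fv_sign_fm [simp]: "fv (sign_fm S f) = fv f" and moduli_sign_fm [simp]: "moduli (sign_fm S f) = moduli f"
  by (simp_all add: sign_fm_def)

abbreviation satA :: "data \<Rightarrow> (nat \<Rightarrow> int) \<Rightarrow> fo \<Rightarrow> bool" where
  "satA A \<equiv> sat (tem A) (\<lambda>a. {l. (a, l) \<in> A})"

lemma sat_sign_fm:
  "(\<forall>f\<in>set fs. sat D P v (sign_fm {f. sat D' P' v' f} f)) \<longleftrightarrow> (\<forall>f\<in>set fs. sat D P v f \<longleftrightarrow> sat D' P' v' f)"
  by (auto simp: sign_fm_def)

text \<open>Hintikka's construction: atomic formulas decide rank 0, and one more rank is decided by
  stating which complete types over the previous list are realised by a further element.\<close>

lemma back_forth_formulas: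
  assumes "finite \<Sigma>" "p > 0" "n > 0"
  shows "\<exists>fs. (\<forall>f\<in>set fs. fv f \<subseteq> {..<n} \<and> moduli f \<subseteq> {p} - {1}) \<and>
    (\<forall>A A' v v'. data_instance A \<longrightarrow> data_instance A' \<longrightarrow> (\<forall>i<n. v i \<in> tem A \<and> v' i \<in> tem A') \<longrightarrow>
      (\<forall>f\<in>set fs. satA A v f \<longleftrightarrow> satA A' v' f) \<longrightarrow>
      back_forth (tem A) (tem A') \<Sigma> p A A' k ((\<lambda>i. (v i, v' i)) ` {..<n}))"
  using assms(3)
proof (induction k arbitrary: n)
  case 0
  obtain as where as: "set as = \<Sigma>" using finite_list[OF assms(1)] by blast
  define fs where "fs = [FPred a i. a \<leftarrow> as, i \<leftarrow> [0..<n]] @ [FLess i j. i \<leftarrow> [0..<n], j \<leftarrow> [0..<n]] @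
    (if p = 1 then [] else [residue_fm p r i. r \<leftarrow> [0..<p], i \<leftarrow> [0..<n]])"
  show ?case
  proof (intro exI[of _ fs] conjI allI impI)
    show "\<forall>f\<in>set fs. fv f \<subseteq> {..<n} \<and> moduli f \<subseteq> {p} - {1}"
      by (auto simp: fs_def fv_residue_fm moduli_residue_fm)
  next
    fix A A' v v'
    assume di: "data_instance A" "data_instance A'" and v: "\<forall>i<n. v i \<in> tem A \<and> v' i \<in> tem A'"
      and agree: "\<forall>f\<in>set fs. satA A v f \<longleftrightarrow> satA A' v' f"
    have tem: "tem A = {0..max_data A}" "tem A' = {0..max_data A'}"
      using di by (auto simp: tem_def data_instance_def)
    have "(a, v i) \<in> A \<longleftrightarrow> (a, v' i) \<in> A'" if "a \<in> \<Sigma>" "i < n" for a i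
    proof -
      have "FPred a i \<in> set [FPred a i. a \<leftarrow> as, i \<leftarrow> [0..<n]]"
        using that by (auto simp: as intro!: bexI[of _ a])
      then have "FPred a i \<in> set fs" by (simp only: fs_def set_append Un_iff simp_thms)
      then show ?thesis using agree by fastforce
    qed
    moreover have "v i < v j \<longleftrightarrow> v' i < v' j" if "i < n" "j < n" for i j
    proof -
      have "FLess i j \<in> set [FLess i j. i \<leftarrow> [0..<n], j \<leftarrow> [0..<n]]"
        using that by (auto intro!: bexI[of _ i])
      then have "FLess i j \<in> set fs" by (simp only: fs_def set_append Un_iff simp_thms)
      then show ?thesis using agree by fastforce
    qed
    moreover have "v i mod int p = v' i mod int p" if "i < n" for i
    proof (cases "p = 1")
      case False
      define r where "r = nat (v i mod int p)"
      have r: "r < p" "v i mod int p = int r" using assms(2) by (auto simp: r_def nat_less_iff)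
      have "residue_fm p r i \<in> set [residue_fm p r i. r \<leftarrow> [0..<p], i \<leftarrow> [0..<n]]"
        using that r by (auto intro!: bexI[of _ r])
      then have "residue_fm p r i \<in> set fs" using False by (simp only: fs_def set_append Un_iff simp_thms if_False)
      then have "satA A v (residue_fm p r i) \<longleftrightarrow> satA A' v' (residue_fm p r i)" using agree by blast
      then show ?thesis using v that r sat_residue_fm[OF r(1)] unfolding tem by simp
    qed simp
    ultimately show "back_forth (tem A) (tem A') \<Sigma> p A A' 0 ((\<lambda>i. (v i, v' i)) ` {..<n})"
      by (auto simp: partial_iso_def)
  qed
next
  case (Suc k)
  obtain fs where fs: "\<forall>f\<in>set fs. fv f \<subseteq> {..<Suc n} \<and> moduli f \<subseteq> {p} - {1}"
    and bf: "\<And>A A' v v'. data_instance A \<Longrightarrow> data_instance A' \<Longrightarrow> (\<forall>i<Suc n. v i \<in> tem A \<and> v' i \<in> tem A') \<Longrightarrow>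
      (\<forall>f\<in>set fs. satA A v f \<longleftrightarrow> satA A' v' f) \<Longrightarrow>
      back_forth (tem A) (tem A') \<Sigma> p A A' k ((\<lambda>i. (v i, v' i)) ` {..<Suc n})"
    using Suc.IH[of "Suc n"] by auto
  obtain Ss where Ss: "set Ss = Pow (set fs)" using finite_list[of "Pow (set fs)"] by auto
  \<comment> \<open>\<open>ex S\<close> asserts a new element of type \<open>S\<close>. Since it
    depends only on \<open>S\<close> within \<open>fs\<close>, the finite list \<open>Ss\<close>
    covers the type of every element.\<close>
  define ex where "ex S = FEx n (conj_fm (map (sign_fm S) fs))" for S
  have ex_cong: "ex S \<in> set (map ex Ss)" for S
  proof -
    have "map (sign_fm S) fs = map (sign_fm (S \<inter> set fs)) fs" by (auto simp: sign_fm_def)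
    then have "ex S = ex (S \<inter> set fs)" by (simp only: ex_def)
    then show ?thesis by (simp add: Ss)
  qed
  show ?case
  proof (intro exI[of _ "map ex Ss"] conjI allI impI)
    show "\<forall>f\<in>set (map ex Ss). fv f \<subseteq> {..<n} \<and> moduli f \<subseteq> {p} - {1}"
      using fs Suc.prems by (fastforce simp: ex_def less_Suc_eq)
  next
    fix A A' v v'
    assume di: "data_instance A" "data_instance A'" and v: "\<forall>i<n. v i \<in> tem A \<and> v' i \<in> tem A'"
      and agree: "\<forall>f\<in>set (map ex Ss). satA A v f \<longleftrightarrow> satA A' v' f"
    have ins: "(\<lambda>i. ((v(n := d)) i, (v'(n := d')) i)) ` {..<Suc n} = insert (d, d') ((\<lambda>i. (v i, v' i)) ` {..<n})" for d d'
      by (auto simp: lessThan_Suc)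
    have step: "back_forth (tem A) (tem A') \<Sigma> p A A' k (insert (d, d') ((\<lambda>i. (v i, v' i)) ` {..<n}))"
      if "d \<in> tem A" "d' \<in> tem A'" "\<forall>f\<in>set fs. satA A (v(n := d)) f \<longleftrightarrow> satA A' (v'(n := d')) f" for d d'
      using bf[OF di _ that(3)] v that(1,2) unfolding ins by (simp add: less_Suc_eq)
    have "\<exists>d'\<in>tem A'. back_forth (tem A) (tem A') \<Sigma> p A A' k (insert (d, d') ((\<lambda>i. (v i, v' i)) ` {..<n}))"
      if d: "d \<in> tem A" for d
    proof -
      have "satA A v (ex {f. satA A (v(n := d)) f})"
        using d by (auto simp: ex_def sat_sign_fm intro!: bexI[of _ d])
      then have "satA A' v' (ex {f. satA A (v(n := d)) f})" using agree ex_cong by blast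
      then obtain d' where "d' \<in> tem A'" "\<forall>f\<in>set fs. satA A' (v'(n := d')) f \<longleftrightarrow> satA A (v(n := d)) f"
        by (auto simp: ex_def sat_sign_fm)
      then show ?thesis using step[OF d] by blast
    qed
    moreover have "\<exists>d\<in>tem A. back_forth (tem A) (tem A') \<Sigma> p A A' k (insert (d, d') ((\<lambda>i. (v i, v' i)) ` {..<n}))"
      if d': "d' \<in> tem A'" for d'
    proof -
      have "satA A' v' (ex {f. satA A' (v'(n := d')) f})"
        using d' by (auto simp: ex_def sat_sign_fm intro!: bexI[of _ d'])
      then have "satA A v (ex {f. satA A' (v'(n := d')) f})" using agree ex_cong by blast
      then obtain d where "d \<in> tem A" "\<forall>f\<in>set fs. satA A (v(n := d)) f \<longleftrightarrow> satA A' (v'(n := d')) f"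
        by (auto simp: ex_def sat_sign_fm)
      then show ?thesis using step[OF _ d'] by blast
    qed
    ultimately show "back_forth (tem A) (tem A') \<Sigma> p A A' (Suc k) ((\<lambda>i. (v i, v' i)) ` {..<n})"
      by simp
  qed
qed

text \<open>The rewriting is the disjunction of the sign patterns found at a certain answer of some
  data instance. Any element with such a pattern is equivalent to that answer, so invariance makes
  it an answer too.\<close>

lemma rewritable_if_invariant:
  assumes "finite \<Sigma>" "p > 0"
    and inv: "\<And>A A' x x'. data_instance A \<Longrightarrow> data_instance A' \<Longrightarrow> x \<in> tem A \<Longrightarrow> x' \<in> tem A' \<Longrightarrow>
      back_forth (tem A) (tem A') \<Sigma> p A A' k {(x, x')} \<Longrightarrow> x \<in> ans q A \<Longrightarrow> x' \<in> ans q A'"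
  shows "rewritable {f. moduli f \<subseteq> {p} - {1}} q"
proof -
  obtain fs where fs: "\<forall>f\<in>set fs. fv f \<subseteq> {0} \<and> moduli f \<subseteq> {p} - {1}"
    and bf: "\<And>A A' v v'. data_instance A \<Longrightarrow> data_instance A' \<Longrightarrow> v 0 \<in> tem A \<Longrightarrow> v' 0 \<in> tem A' \<Longrightarrow>
      (\<forall>f\<in>set fs. satA A v f \<longleftrightarrow> satA A' v' f) \<Longrightarrow>
      back_forth (tem A) (tem A') \<Sigma> p A A' k {(v 0, v' 0)}"
    using back_forth_formulas[OF assms(1,2), of 1 k] by (auto simp: lessThan_Suc)
  define pos where "pos = {S \<in> Pow (set fs). \<exists>A x. data_instance A \<and> x \<in> ans q A \<and> (\<forall>f\<in>set fs. f \<in> S \<longleftrightarrow> satA A (\<lambda>_. x) f)}"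
  have "finite pos" by (simp add: pos_def)
  then obtain Ss where Ss: "set Ss = pos" using finite_list by blast
  define Q where "Q = disj_fm (map (\<lambda>S. conj_fm (map (sign_fm S) fs)) Ss)"
  show ?thesis
    unfolding rewritable_def
  proof (intro bexI[of _ Q] exI[of _ 0] conjI allI impI)
    show "Q \<in> {f. moduli f \<subseteq> {p} - {1}}" using fs by (auto simp: Q_def)
    show "fv Q = {0}" using fs by (auto simp: Q_def)
    fix A assume A: "data_instance A"
    have "x \<in> ans q A \<longleftrightarrow> data_sat A (\<lambda>_. x) Q" if x: "x \<in> tem A" for x
    proof
      assume a: "x \<in> ans q A"
      define S where "S = {f \<in> set fs. satA A (\<lambda>_. x) f}"
      have "S \<in> pos" using A a by (auto simp: pos_def S_def)
      moreover have "\<forall>f\<in>set fs. satA A (\<lambda>_. x) (sign_fm S f)" by (auto simp: sign_fm_def S_def)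
      ultimately show "data_sat A (\<lambda>_. x) Q" by (auto simp: data_sat_def Q_def Ss)
    next
      assume "data_sat A (\<lambda>_. x) Q"
      then obtain S where "S \<in> pos" and S: "\<forall>f\<in>set fs. satA A (\<lambda>_. x) (sign_fm S f)"
        by (auto simp: data_sat_def Q_def Ss)
      then obtain A' x' where A': "data_instance A'" "x' \<in> ans q A'"
        "\<forall>f\<in>set fs. f \<in> S \<longleftrightarrow> satA A' (\<lambda>_. x') f"
        by (auto simp: pos_def)
      have "\<forall>f\<in>set fs. satA A' (\<lambda>_. x') f \<longleftrightarrow> satA A (\<lambda>_. x) f"
        using S A'(3) by (auto simp: sign_fm_def split: if_splits)
      moreover have x': "x' \<in> tem A'" using A'(2) by (simp add: ans_def)
      ultimately have "back_forth (tem A') (tem A) \<Sigma> p A' A k {(x', x)}"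
        using bf[OF A'(1) A, of "\<lambda>_. x'" "\<lambda>_. x"] x by blast
      then show "x \<in> ans q A" using inv[OF A'(1) A x' x] A'(2) by blast
    qed
    then show "ans q A = {l \<in> tem A. data_sat A (\<lambda>_. l) Q}" by (auto simp: ans_def)
  qed
qed

section \<open>Sets invariant under back-and-forth equivalence\<close>

lemma bfZ_mono: "bfZ \<Sigma> p A A' k R \<Longrightarrow> j \<le> k \<Longrightarrow> bfZ \<Sigma> p A A' j R"
  using back_forth_mono[of UNIV] by blast

lemma bfZ_partial_iso: "bfZ \<Sigma> p A A' k R \<Longrightarrow> partial_iso \<Sigma> p A A' R"
  using back_forth_partial_iso[of UNIV] by blast

lemma bfZ_less:
  "bfZ \<Sigma> p A A' k R \<Longrightarrow> (x, x') \<in> R \<Longrightarrow> (y, y') \<in> R \<Longrightarrow> x < y \<longleftrightarrow> x' < y'"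
  using bfZ_partial_iso unfolding partial_iso_def by blast

lemma bfZ_forth:
  assumes "bfZ \<Sigma> p A A' (Suc k) R"
  obtains d' where "bfZ \<Sigma> p A A' k (insert (d, d') R)"
  using assms by auto

lemma bfZ_back:
  assumes "bfZ \<Sigma> p A A' (Suc k) R"
  obtains d where "bfZ \<Sigma> p A A' k (insert (d, d') R)"
  using assms by auto

lemma bfZ_converse: "bfZ \<Sigma> p A A' k R \<Longrightarrow> bfZ \<Sigma> p A' A k (R\<inverse>)"
  by (rule back_forth_converse)

text \<open>Each round gains one unit: playing \<open>x + 1\<close> forces a reply strictly above
  \<open>x'\<close>, and the remaining rounds bound the distance from there.\<close>

lemma bfZ_distance_ge:
  assumes "bfZ \<Sigma> p A A' j R" "(x, x') \<in> R" "(y, y') \<in> R" "y - x \<ge> int (Suc j)"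
  shows "y' - x' \<ge> int (Suc j)"
  using assms
proof (induction j arbitrary: R x x')
  case 0
  then show ?case using bfZ_less[OF 0(1-3)] by simp
next
  case (Suc j)
  obtain z' where z: "bfZ \<Sigma> p A A' j (insert (x + 1, z') R)" using bfZ_forth[OF Suc.prems(1)] .
  have "y' - z' \<ge> int (Suc j)" using Suc.IH[OF z, of "x + 1" z'] Suc.prems by simp
  moreover have "x' < z'" using bfZ_less[OF z, of x x' "x + 1" z'] Suc.prems by simp
  ultimately show ?case by simp
qed

lemma bfZ_distance_ge_iff:
  assumes "bfZ \<Sigma> p A A' k R" "(x, x') \<in> R" "(y, y') \<in> R" "1 \<le> j" "j \<le> int k"
  shows "y - x \<ge> j \<longleftrightarrow> y' - x' \<ge> j"
proof -
  obtain i where i: "j = int (Suc i)" by (rule that[of "nat (j - 1)"]) (use assms(4) in simp)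
  have "bfZ \<Sigma> p A A' i R" using bfZ_mono[OF assms(1)] assms(5) i by simp
  then show ?thesis
    using bfZ_distance_ge[of \<Sigma> p A A' i R x x' y y'] bfZ_distance_ge[of \<Sigma> p A' A i "R\<inverse>" x' x y' y]
      bfZ_converse assms(2,3) unfolding i by auto
qed

text \<open>Short distances are matched exactly, long ones only up to direction; with the residues
  kept by \<open>partial_iso\<close> this is just what an ultimately periodic set can
  distinguish.\<close>

lemma bfZ_distance:
  assumes "bfZ \<Sigma> p A A' k R" "(x, x') \<in> R" "(y, y') \<in> R"
  shows "y - x = y' - x' \<or> (y - x \<ge> int k \<and> y' - x' \<ge> int k) \<or> (y - x \<le> - int k \<and> y' - x' \<le> - int k)"
proof -
  note le = bfZ_less[OF assms] bfZ_less[OF assms(1,3,2)]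
  show ?thesis
  proof (cases "y - x \<ge> 0")
    case True
    then have "y' - x' \<ge> 0" using le by simp
    show ?thesis
      using bfZ_distance_ge_iff[OF assms, of "y - x"] bfZ_distance_ge_iff[OF assms, of "y' - x'"]
        bfZ_distance_ge_iff[OF assms, of "int k"] True \<open>y' - x' \<ge> 0\<close> le by force
  next
    case False
    then have "y' < x'" using le by simp
    then show ?thesis
      using bfZ_distance_ge_iff[OF assms(1,3,2), of "x - y"] bfZ_distance_ge_iff[OF assms(1,3,2), of "x' - y'"]
        bfZ_distance_ge_iff[OF assms(1,3,2), of "int k"] False by force
  qed
qed

text \<open>Both tails have period \<open>p\<close>, while the pattern may differ between the tails
  and be arbitrary in the middle. One implication suffices, as \<open>z\<close> and
  \<open>z'\<close> are interchangeable.\<close>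

definition ult_periodic :: "nat \<Rightarrow> int set \<Rightarrow> bool" where
  "ult_periodic p U \<longleftrightarrow> (\<exists>J. \<forall>z z'. (z \<ge> J \<and> z' \<ge> J \<or> z \<le> -J \<and> z' \<le> -J) \<longrightarrow>
     z mod int p = z' mod int p \<longrightarrow> z \<in> U \<longrightarrow> z' \<in> U)"

text \<open>The integer parameters indexed by \<open>B\<close> will be the thresholds of boxed concepts. The rank is
  uniform in \<open>g\<close>, which will say which rays are empty, proper or the whole line.\<close>

locale invariance =
  fixes \<Sigma> :: "atom set" and p :: nat and B :: "'b set"
begin

text \<open>The semantic counterpart of definability by a formula of quantifier rank
  \<open>k\<close> with parameters \<open>t\<close>, which must already have been played. One
  implication suffices, because the game is symmetric.\<close>

definition preserved :: "nat \<Rightarrow> ('g \<Rightarrow> data \<Rightarrow> ('b \<Rightarrow> int) \<Rightarrow> int set) \<Rightarrow> bool" where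
  "preserved k X \<longleftrightarrow> (\<forall>g A A' t t' R x x'. bfZ \<Sigma> p A A' k R \<longrightarrow> (\<forall>b\<in>B. (t b, t' b) \<in> R) \<longrightarrow> (x, x') \<in> R \<longrightarrow>
     x \<in> X g A t \<longrightarrow> x' \<in> X g A' t')"

definition invariant :: "('g \<Rightarrow> data \<Rightarrow> ('b \<Rightarrow> int) \<Rightarrow> int set) \<Rightarrow> bool" where
  "invariant X \<longleftrightarrow> (\<exists>k. preserved k X)"

lemma preservedI:
  assumes "\<And>g A A' t t' R x x'. bfZ \<Sigma> p A A' k R \<Longrightarrow> \<forall>b\<in>B. (t b, t' b) \<in> R \<Longrightarrow> (x, x') \<in> R \<Longrightarrow>
    x \<in> X g A t \<Longrightarrow> x' \<in> X g A' t'"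
  shows "preserved k X"
  unfolding preserved_def using assms by blast

lemma preservedD:
  assumes "preserved k X" "bfZ \<Sigma> p A A' j R" "k \<le> j" "\<forall>b\<in>B. (t b, t' b) \<in> R" "(x, x') \<in> R"
  shows "x \<in> X g A t \<longleftrightarrow> x' \<in> X g A' t'"
proof
  have bf: "bfZ \<Sigma> p A A' k R" using bfZ_mono[OF assms(2,3)] .
  show "x \<in> X g A t \<Longrightarrow> x' \<in> X g A' t'" using assms(1,4,5) bf unfolding preserved_def by blast
  have "bfZ \<Sigma> p A' A k (R\<inverse>)" "\<forall>b\<in>B. (t' b, t b) \<in> R\<inverse>" "(x', x) \<in> R\<inverse>"
    using bfZ_converse[OF bf] assms(4,5) by auto
  then show "x' \<in> X g A' t' \<Longrightarrow> x \<in> X g A t" using assms(1) unfolding preserved_def by blast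
qed

lemma preserved_mono:
  assumes "preserved k X" "k \<le> j"
  shows "preserved j X"
proof (rule preservedI)
  fix g A A' t t' R x x'
  assume *: "bfZ \<Sigma> p A A' j R" "\<forall>b\<in>B. (t b, t' b) \<in> R" "(x, x') \<in> R" "x \<in> X g A t"
  show "x' \<in> X g A' t'" using preservedD[OF assms(1) *(1) assms(2) *(2,3), of g] *(4) by blast
qed

lemma preserved_family:
  assumes "finite I" "\<And>i. i \<in> I \<Longrightarrow> invariant (X i)"
  obtains k where "\<And>i. i \<in> I \<Longrightarrow> preserved k (X i)"
proof -
  obtain f where f: "\<And>i. i \<in> I \<Longrightarrow> preserved (f i) (X i)"
    using bchoice[of I "\<lambda>i k. preserved k (X i)"] assms(2) unfolding invariant_def by blast
  have "preserved (Max (f ` I)) (X i)" if "i \<in> I" for i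
    using preserved_mono[OF f[OF that]] assms(1) that by simp
  then show thesis by (rule that)
qed

lemma preserved2:
  assumes "invariant X" "invariant Y"
  obtains k where "preserved k X" "preserved k Y"
proof -
  obtain i j where "preserved i X" "preserved j Y" using assms unfolding invariant_def by blast
  then show thesis by (intro that[of "max i j"]) (auto elim: preserved_mono)
qed

section \<open>Invariance under Boolean and temporal operations\<close>

lemma invariant_const: "invariant (\<lambda>g A t. {x. P g})"
  unfolding invariant_def preserved_def by simp

lemma invariant_empty: "invariant (\<lambda>g A t. {})" and invariant_UNIV: "invariant (\<lambda>g A t. UNIV)"
  using invariant_const[of "\<lambda>_. False"] invariant_const[of "\<lambda>_. True"] by simp_all

lemma invariant_Un:
  assumes "invariant X" "invariant Y" shows "invariant (\<lambda>g A t. X g A t \<union> Y g A t)"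
proof -
  obtain k where k: "preserved k X" "preserved k Y" using preserved2[OF assms] .
  have "preserved k (\<lambda>g A t. X g A t \<union> Y g A t)"
  proof (rule preservedI)
    fix g A A' t t' R x x'
    assume *: "bfZ \<Sigma> p A A' k R" "\<forall>b\<in>B. (t b, t' b) \<in> R" "(x, x') \<in> R" "x \<in> X g A t \<union> Y g A t"
    show "x' \<in> X g A' t' \<union> Y g A' t'"
      using preservedD[OF k(1) *(1) order_refl *(2,3), of g] preservedD[OF k(2) *(1) order_refl *(2,3), of g] *(4) by blast
  qed
  then show ?thesis unfolding invariant_def by blast
qed

lemma invariant_Compl:
  assumes "invariant X" shows "invariant (\<lambda>g A t. - X g A t)"
proof -
  obtain k where k: "preserved k X" using assms unfolding invariant_def by blast
  have "preserved k (\<lambda>g A t. - X g A t)"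
  proof (rule preservedI)
    fix g A A' t t' R x x'
    assume *: "bfZ \<Sigma> p A A' k R" "\<forall>b\<in>B. (t b, t' b) \<in> R" "(x, x') \<in> R" "x \<in> - X g A t"
    show "x' \<in> - X g A' t'" using preservedD[OF k *(1) order_refl *(2,3), of g] *(4) by blast
  qed
  then show ?thesis unfolding invariant_def by blast
qed

lemma invariant_Int:
  assumes "invariant X" "invariant Y" shows "invariant (\<lambda>g A t. X g A t \<inter> Y g A t)"
  using invariant_Compl[OF invariant_Un[OF assms[THEN invariant_Compl]]] by simp

lemma invariant_UN:
  assumes "finite I" "\<And>i. i \<in> I \<Longrightarrow> invariant (X i)"
  shows "invariant (\<lambda>g A t. \<Union>i\<in>I. X i g A t)"
proof -
  obtain k where "\<And>i. i \<in> I \<Longrightarrow> preserved k (X i)" using preserved_family[of I X] assms by blast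
  then have k: "i \<in> I \<Longrightarrow> preserved k (X i)" for i by blast
  have "preserved k (\<lambda>g A t. \<Union>i\<in>I. X i g A t)"
  proof (rule preservedI)
    fix g A A' t t' R x x'
    assume *: "bfZ \<Sigma> p A A' k R" "\<forall>b\<in>B. (t b, t' b) \<in> R" "(x, x') \<in> R"
      and "x \<in> (\<Union>i\<in>I. X i g A t)"
    then obtain i where i: "i \<in> I" "x \<in> X i g A t" by blast
    have "x' \<in> X i g A' t'" using preservedD[OF k[OF i(1)] *(1) order_refl *(2,3), of g] i(2) by blast
    then show "x' \<in> (\<Union>i\<in>I. X i g A' t')" using i(1) by blast
  qed
  then show ?thesis unfolding invariant_def by blast
qed

lemma invariant_INT:
  assumes "finite I" "\<And>i. i \<in> I \<Longrightarrow> invariant (X i)"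
  shows "invariant (\<lambda>g A t. \<Inter>i\<in>I. X i g A t)"
  using invariant_Compl[OF invariant_UN[OF assms(1) assms(2)[THEN invariant_Compl]]] by simp

text \<open>Two more rounds: one to transfer the witness \<open>y\<close> forth, one to pull a
  challenge \<open>m'\<close> in between back.\<close>

lemma invariant_until:
  assumes "invariant X" "invariant Y" shows "invariant (\<lambda>g A t. until (X g A t) (Y g A t))"
proof -
  obtain k where k: "preserved k X" "preserved k Y" using preserved2[OF assms] .
  have "preserved (Suc (Suc k)) (\<lambda>g A t. until (X g A t) (Y g A t))"
  proof (rule preservedI)
    fix g A A' t t' R x x'
    assume bf: "bfZ \<Sigma> p A A' (Suc (Suc k)) R" and B: "\<forall>b\<in>B. (t b, t' b) \<in> R" and x: "(x, x') \<in> R"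
      and "x \<in> until (X g A t) (Y g A t)"
    then obtain y where y: "x < y" "y \<in> Y g A t" "\<And>m. x < m \<Longrightarrow> m < y \<Longrightarrow> m \<in> X g A t"
      unfolding until_def by blast
    obtain y' where bf2: "bfZ \<Sigma> p A A' (Suc k) (insert (y, y') R)" using bfZ_forth[OF bf] .
    have "x' < y'" using bfZ_less[OF bf2] x y(1) by blast
    moreover have "y' \<in> Y g A' t'" using preservedD[OF k(2) bf2, of t t' y y'] B y(2) by simp
    moreover have "m' \<in> X g A' t'" if m': "x' < m'" "m' < y'" for m'
    proof -
      obtain m where bf3: "bfZ \<Sigma> p A A' k (insert (m, m') (insert (y, y') R))" using bfZ_back[OF bf2] .
      have "x < m" "m < y" using bfZ_less[OF bf3] x m' by blast+
      then have "m \<in> X g A t" by (rule y(3))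
      then show ?thesis using preservedD[OF k(1) bf3, of t t' m m' g] B by simp
    qed
    ultimately show "x' \<in> until (X g A' t') (Y g A' t')" unfolding until_def by blast
  qed
  then show ?thesis unfolding invariant_def by blast
qed

lemma invariant_since:
  assumes "invariant X" "invariant Y" shows "invariant (\<lambda>g A t. since (X g A t) (Y g A t))"
proof -
  obtain k where k: "preserved k X" "preserved k Y" using preserved2[OF assms] .
  have "preserved (Suc (Suc k)) (\<lambda>g A t. since (X g A t) (Y g A t))"
  proof (rule preservedI)
    fix g A A' t t' R x x'
    assume bf: "bfZ \<Sigma> p A A' (Suc (Suc k)) R" and B: "\<forall>b\<in>B. (t b, t' b) \<in> R" and x: "(x, x') \<in> R"
      and "x \<in> since (X g A t) (Y g A t)"
    then obtain y where y: "y < x" "y \<in> Y g A t" "\<And>m. y < m \<Longrightarrow> m < x \<Longrightarrow> m \<in> X g A t"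
      unfolding since_def by blast
    obtain y' where bf2: "bfZ \<Sigma> p A A' (Suc k) (insert (y, y') R)" using bfZ_forth[OF bf] .
    have "y' < x'" using bfZ_less[OF bf2] x y(1) by blast
    moreover have "y' \<in> Y g A' t'" using preservedD[OF k(2) bf2, of t t' y y'] B y(2) by simp
    moreover have "m' \<in> X g A' t'" if m': "y' < m'" "m' < x'" for m'
    proof -
      obtain m where bf3: "bfZ \<Sigma> p A A' k (insert (m, m') (insert (y, y') R))" using bfZ_back[OF bf2] .
      have "y < m" "m < x" using bfZ_less[OF bf3] x m' by blast+
      then have "m \<in> X g A t" by (rule y(3))
      then show ?thesis using preservedD[OF k(1) bf3, of t t' m m' g] B by simp
    qed
    ultimately show "x' \<in> since (X g A' t') (Y g A' t')" unfolding since_def by blast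
  qed
  then show ?thesis unfolding invariant_def by blast
qed

text \<open>Strictness of the operators makes the next point the one reached with nothing in
  between. All unary operators thereby reduce to \<open>until\<close>, \<open>since\<close> and
  complement.\<close>

lemma next_eq_until: "next_F X = until {} X" "next_P X = since {} X"
proof -
  have "k = n + 1" if "n < k" "\<forall>m. \<not> (n < m \<and> m < k)" for n k :: int
    using that(1) spec[OF that(2), of "n + 1"] by simp
  then show "next_F X = until {} X" unfolding next_F_def until_def by (auto intro: exI[of _ "n + 1" for n])
  have "k = n - 1" if "k < n" "\<forall>m. \<not> (k < m \<and> m < n)" for n k :: int
    using that(1) spec[OF that(2), of "n - 1"] by simp
  moreover have "\<exists>k<n. k \<in> X \<and> (\<forall>m>k. \<not> m < n)" if "n - 1 \<in> X" for n
    using that by (intro exI[of _ "n - 1"]) auto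
  ultimately show "next_P X = since {} X" unfolding next_P_def since_def by auto
qed

lemma dia_box_eq_until:
  "dia_F X = until UNIV X" "dia_P X = since UNIV X"
  "box_F X = - dia_F (- X)" "box_P X = - dia_P (- X)"
  by (auto simp: dia_F_def until_def dia_P_def since_def box_F_def box_P_def)

lemma invariant_temporal:
  assumes "invariant X"
  shows "invariant (\<lambda>g A t. next_F (X g A t))" "invariant (\<lambda>g A t. next_P (X g A t))"
    "invariant (\<lambda>g A t. dia_F (X g A t))" "invariant (\<lambda>g A t. dia_P (X g A t))"
    "invariant (\<lambda>g A t. box_F (X g A t))" "invariant (\<lambda>g A t. box_P (X g A t))"
  unfolding next_eq_until dia_box_eq_until
  by (intro invariant_until invariant_since invariant_Compl invariant_empty invariant_UNIV assms)+

lemma invariant_tempop: "invariant X \<Longrightarrow> invariant (\<lambda>g A t. tempop_ext f (X g A t))"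
  by (cases f) (simp_all add: invariant_temporal)

lemma invariant_data: "a \<in> \<Sigma> \<Longrightarrow> invariant (\<lambda>g A t. {x. (a, x) \<in> A})"
  unfolding invariant_def
  by (rule exI[of _ 0], rule preservedI) (auto simp: partial_iso_def)

lemma invariant_rays:
  assumes "b \<in> B"
  shows "invariant (\<lambda>g A t. {x. t b \<le> x})" "invariant (\<lambda>g A t. {x. x \<le> t b})"
proof -
  have *: "t b \<le> x \<longleftrightarrow> t' b \<le> x'" "x \<le> t b \<longleftrightarrow> x' \<le> t' b"
    if "bfZ \<Sigma> p A A' 0 R" "(t b, t' b) \<in> R" "(x, x') \<in> R" for A A' R t t' x x'
    using bfZ_less[OF that(1,2,3)] bfZ_less[OF that(1,3,2)] by linarith+
  have "preserved 0 (\<lambda>g A t. {x. t b \<le> x})"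
    unfolding preserved_def mem_Collect_eq using *(1) assms by blast
  moreover have "preserved 0 (\<lambda>g A t. {x. x \<le> t b})"
    unfolding preserved_def mem_Collect_eq using *(2) assms by blast
  ultimately show "invariant (\<lambda>g A t. {x. t b \<le> x})" "invariant (\<lambda>g A t. {x. x \<le> t b})"
    unfolding invariant_def by blast+
qed

lemma invariant_distance:
  assumes "invariant X" "ult_periodic p U"
  shows "invariant (\<lambda>g A t. {x. \<exists>y\<in>X g A t. x - y \<in> U})"
proof -
  obtain k where k: "preserved k X" using assms(1) unfolding invariant_def by blast
  obtain J where J: "\<And>z z'. (z \<ge> J \<and> z' \<ge> J \<or> z \<le> -J \<and> z' \<le> -J) \<Longrightarrow>
     z mod int p = z' mod int p \<Longrightarrow> z \<in> U \<Longrightarrow> z' \<in> U"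
    using assms(2) unfolding ult_periodic_def by blast
  \<comment> \<open>One round transfers the source \<open>y\<close>; of the rest, \<open>k\<close>
    keep it in \<open>X\<close>, and \<open>nat J\<close> make its distance from \<open>x\<close>
    either exact or beyond the periodicity bound.\<close>
  have "preserved (Suc (k + nat J)) (\<lambda>g A t. {x. \<exists>y\<in>X g A t. x - y \<in> U})"
  proof (rule preservedI)
    fix g A A' t t' R x x'
    assume bf: "bfZ \<Sigma> p A A' (Suc (k + nat J)) R" and B: "\<forall>b\<in>B. (t b, t' b) \<in> R" and x: "(x, x') \<in> R"
      and "x \<in> {x. \<exists>y\<in>X g A t. x - y \<in> U}"
    then obtain y where y: "y \<in> X g A t" "x - y \<in> U" by blast
    obtain y' where bf2: "bfZ \<Sigma> p A A' (k + nat J) (insert (y, y') R)" using bfZ_forth[OF bf] .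
    have "y' \<in> X g A' t'" using preservedD[OF k bf2, of t t' y y'] B y(1) by simp
    moreover have "x' - y' \<in> U"
    proof -
      have "x mod int p = x' mod int p" "y mod int p = y' mod int p"
        using bfZ_partial_iso[OF bf2] x unfolding partial_iso_def by blast+
      then have "(x - y) mod int p = (x' - y') mod int p" by (rule mod_diff_cong)
      moreover have "x - y = x' - y' \<or> (x - y \<ge> J \<and> x' - y' \<ge> J) \<or> (x - y \<le> -J \<and> x' - y' \<le> -J)"
        using bfZ_distance[OF bf2 insertI1 insertI2[OF x]] unfolding of_nat_add by linarith
      ultimately show ?thesis using J y(2) by metis
    qed
    ultimately show "x' \<in> {x. \<exists>y\<in>X g A' t'. x - y \<in> U}" by blast
  qed
  then show ?thesis unfolding invariant_def by blast
qed

text \<open>A threshold vector costs one round per entry. The vector is given on the primed side,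
  since a statement about all vectors over \<open>A\<close> has to be carried over to
  \<open>A'\<close>.\<close>

lemma bfZ_back_params:
  assumes "finite C" "bfZ \<Sigma> p A A' (k + card C) R"
  shows "\<exists>t. bfZ \<Sigma> p A A' k (R \<union> (\<lambda>b. (t b, t' b)) ` C)"
  using assms
proof (induction C arbitrary: k rule: finite_induct)
  case empty
  then show ?case by simp
next
  case (insert c C)
  have "bfZ \<Sigma> p A A' (Suc k + card C) R"
    using insert.prems unfolding card_insert_disjoint[OF insert.hyps] add_Suc add_Suc_right .
  then obtain t where t: "bfZ \<Sigma> p A A' (Suc k) (R \<union> (\<lambda>b. (t b, t' b)) ` C)"
    using insert.IH by blast
  obtain d where d: "bfZ \<Sigma> p A A' k (insert (d, t' c) (R \<union> (\<lambda>b. (t b, t' b)) ` C))" using bfZ_back[OF t] .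
  have eq: "insert (d, t' c) (R \<union> (\<lambda>b. (t b, t' b)) ` C) = R \<union> (\<lambda>b. ((t(c := d)) b, t' b)) ` insert c C"
    using insert.hyps(2) by auto
  show ?case by (rule exI[of _ "t(c := d)"], rule d[unfolded eq])
qed

end

section \<open>Walks with bounded weights\<close>

inductive walk :: "('a \<times> int \<times> 'a) set \<Rightarrow> 'a \<Rightarrow> int \<Rightarrow> 'a \<Rightarrow> bool" for W where
  walk_refl: "walk W c 0 c"
| walk_step: "walk W c z d \<Longrightarrow> (d, w, e) \<in> W \<Longrightarrow> walk W c (z + w) e"

lemma walk_append: "walk W d w e \<Longrightarrow> walk W c z d \<Longrightarrow> walk W c (z + w) e"
  by (induction rule: walk.induct) (auto simp: add.assoc[symmetric] intro: walk_step)

lemma walk_cases_field: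
  assumes "walk W c z e" "\<And>d w e. (d, w, e) \<in> W \<Longrightarrow> d \<in> F \<and> e \<in> F"
  shows "c = e \<and> z = 0 \<or> c \<in> F \<and> e \<in> F"
  using assms(1) by (induction rule: walk.induct) (use assms(2) in auto)

text \<open>A discrete intermediate value argument: the partial sums start at 0 and rise by at most
  1 per step, so they cannot jump over \<open>m\<close>.\<close>

lemma walk_split:
  assumes "walk W c z e" "\<And>d w e. (d, w, e) \<in> W \<Longrightarrow> w \<le> 1" "0 \<le> m" "m \<le> z"
  shows "\<exists>d. walk W c m d \<and> walk W d (z - m) e"
  using assms(1,3,4)
proof (induction rule: walk.induct)
  case (walk_refl c)
  then show ?case by (auto intro: walk.walk_refl)
next
  case (walk_step c z d w e)
  show ?case
  proof (cases "m \<le> z")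
    case True
    then obtain f where f: "walk W c m f" "walk W f (z - m) d" using walk_step by blast
    have "walk W f (z - m + w) e" using walk.walk_step[OF f(2) walk_step.hyps(2)] .
    then show ?thesis using f(1) by (auto simp: algebra_simps)
  next
    case False
    then have "m = z + w" using assms(2)[OF walk_step.hyps(2)] walk_step.prems by linarith
    moreover have "walk W c (z + w) e" using walk.walk_step[OF walk_step.hyps] .
    ultimately show ?thesis by (auto intro: walk.walk_refl)
  qed
qed

lemma walk_uminus: "walk W c z e \<Longrightarrow> walk ((\<lambda>(d, w, e). (d, -w, e)) ` W) c (-z) e"
proof (induction rule: walk.induct)
  case (walk_step c z d w e)
  then have "(d, -w, e) \<in> (\<lambda>(d, w, e). (d, -w, e)) ` W" by force
  from walk.walk_step[OF walk_step.IH this] show ?case by simp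
qed (use walk.walk_refl in simp)

lemma walk_uminus_iff: "walk ((\<lambda>(d, w, e). (d, -w, e)) ` W) c (-z) e \<longleftrightarrow> walk W c z e"
proof -
  have "(\<lambda>(d, w, e). (d, -w, e)) ` (\<lambda>(d, w, e). (d, -w, e)) ` W = W"
    by (simp add: image_image case_prod_beta)
  then show ?thesis using walk_uminus[of W c z e] walk_uminus[of "(\<lambda>(d, w, e). (d, -w, e)) ` W" c "-z" e] by auto
qed

text \<open>The relations \<open>\<lambda>c e. walk W c m e\<close>, for \<open>m = 1, 2, \<dots>\<close>, are the powers of the one for \<open>m = 1\<close>.\<close>

lemma walk_eventually_periodic:
  assumes "finite F" "\<And>d w e. (d, w, e) \<in> W \<Longrightarrow> d \<in> F \<and> e \<in> F" "\<And>d w e. (d, w, e) \<in> W \<Longrightarrow> w \<le> 1"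
  shows "\<exists>J q. q > 0 \<and> (\<forall>m\<ge>J. \<forall>c e. walk W c (m + q) e \<longleftrightarrow> walk W c m e)"
proof -
  \<comment> \<open>The shift by one excludes weight 0, where the empty walk relates every
    \<open>c\<close> to itself, even outside \<open>F\<close>. Positive weights need an edge, so
    \<open>Y n\<close> lies in the finite set \<open>F \<times> F\<close> and two of these relations
    coincide.\<close>
  define Y where "Y n = {(c, e). walk W c (int n + 1) e}" for n :: nat
  have "Y n \<subseteq> F \<times> F" for n using walk_cases_field[OF _ assms(2)] by (fastforce simp: Y_def)
  then have "finite (range Y)" using assms(1) by (meson finite_Pow_iff finite_SigmaI finite_subset image_subsetI PowI)
  then have "\<not> inj Y" using finite_imageD infinite_UNIV_nat by blast
  then obtain i j where ij: "i < j" "Y i = Y j" unfolding inj_def by (metis linorder_neqE_nat)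
  have Suc: "Y (Suc n) = Y n O Y 0" for n
  proof
    show "Y (Suc n) \<subseteq> Y n O Y 0"
    proof
      fix x assume "x \<in> Y (Suc n)"
      then obtain c e where x: "x = (c, e)" "walk W c (int (Suc n) + 1) e" by (auto simp: Y_def)
      have "\<exists>d. walk W c (int n + 1) d \<and> walk W d (int (Suc n) + 1 - (int n + 1)) e"
        by (rule walk_split[OF x(2)]) (erule assms(3), simp_all)
      then obtain d where "walk W c (int n + 1) d" "walk W d 1 e" by auto
      then show "x \<in> Y n O Y 0" unfolding x(1) Y_def by auto
    qed
    show "Y n O Y 0 \<subseteq> Y (Suc n)"
    proof
      fix x assume "x \<in> Y n O Y 0"
      then obtain c d e where x: "x = (c, e)" "walk W c (int n + 1) d" "walk W d 1 e" by (auto simp: Y_def)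
      then have "walk W c (int n + 1 + 1) e" using walk_append by fast
      then show "x \<in> Y (Suc n)" unfolding x(1) Y_def by (simp add: algebra_simps)
    qed
  qed
  have per: "Y (i + n) = Y (j + n)" for n by (induction n) (simp_all add: ij Suc)
  show ?thesis
  proof (rule exI[of _ "int i + 1"], rule exI[of _ "int j - int i"], intro conjI allI impI)
    show "int j - int i > 0" using ij by simp
    fix m c e assume m: "int i + 1 \<le> m"
    define n where "n = nat (m - int i - 1)"
    have n: "m = int (i + n) + 1" "m + (int j - int i) = int (j + n) + 1" using m by (auto simp: n_def)
    have "(c, e) \<in> Y (i + n) \<longleftrightarrow> (c, e) \<in> Y (j + n)" using per by simp
    then show "walk W c (m + (int j - int i)) e \<longleftrightarrow> walk W c m e" unfolding n(2) unfolding n(1) Y_def by simp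
  qed
qed

lemma eventually_periodic_cong:
  fixes P :: "int \<Rightarrow> bool"
  assumes per: "\<And>m. m \<ge> J \<Longrightarrow> P (m + q) = P m" and "q > 0" "z \<ge> J" "z' \<ge> J" "q dvd z' - z"
  shows "P z = P z'"
proof -
  have *: "P (m + int n * q) = P m" if "m \<ge> J" for m n
  proof (induction n)
    case (Suc n)
    have "m + int n * q \<ge> J" using that \<open>q > 0\<close> by (simp add: add_increasing2)
    then have "P (m + int n * q + q) = P (m + int n * q)" by (rule per)
    then show ?case using Suc by (simp add: algebra_simps)
  qed simp
  have **: "P a = P b" if ab: "a \<ge> J" "a \<le> b" "q dvd b - a" for a b
  proof -
    obtain k where k: "b - a = q * k" using ab(3) by blast
    then have "k \<ge> 0" using ab(2) \<open>q > 0\<close> by (metis diff_ge_0_iff_ge zero_le_mult_iff not_less)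
    then have "b = a + int (nat k) * q" using k by (simp add: algebra_simps)
    then show ?thesis using *[OF ab(1), of "nat k"] by simp
  qed
  show ?thesis
  proof (cases "z \<le> z'")
    case True
    then show ?thesis using **[of z z'] assms by blast
  next
    case False
    then show ?thesis using **[of z' z] assms by (simp add: dvd_diff_commute)
  qed
qed

lemma walk_ult_periodic:
  assumes "finite F" "\<And>d w e. (d, w, e) \<in> W \<Longrightarrow> d \<in> F \<and> e \<in> F" "\<And>d w e. (d, w, e) \<in> W \<Longrightarrow> \<bar>w\<bar> \<le> 1"
  shows "\<exists>p>0. \<forall>c e. ult_periodic p {z. walk W c z e}"
proof -
  let ?V = "(\<lambda>(d, w, e). (d, -w, e)) ` W"
  obtain J q where q: "q > 0" "\<And>m c e. m \<ge> J \<Longrightarrow> walk W c (m + q) e \<longleftrightarrow> walk W c m e"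
    using walk_eventually_periodic[OF assms(1,2), of W] assms(3) by fastforce
  obtain J' q' where q': "q' > 0" "\<And>m c e. m \<ge> J' \<Longrightarrow> walk ?V c (m + q') e \<longleftrightarrow> walk ?V c m e"
    using walk_eventually_periodic[OF assms(1), of ?V] assms(2,3) by fastforce
  \<comment> \<open>\<open>q\<close> and \<open>q'\<close> are periods of the upward and the
    downward tail, the latter obtained by negating all weights. Both are uniform in the endpoints,
    so their product works for all pairs at once.\<close>
  define p where "p = nat (q * q')"
  have p: "int p = q * q'" "p > 0" using q(1) q'(1) by (auto simp: p_def)
  have "ult_periodic p {z. walk W c z e}" for c e
    unfolding ult_periodic_def
  proof (intro exI[of _ "max J J'"] allI impI)
    fix z z'
    assume J: "z \<ge> max J J' \<and> z' \<ge> max J J' \<or> z \<le> - max J J' \<and> z' \<le> - max J J'"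
      and "z mod int p = z' mod int p" and z: "z \<in> {z. walk W c z e}"
    then have d: "int p dvd z' - z" by (metis mod_eq_dvd_iff)
    from J show "z' \<in> {z. walk W c z e}"
    proof
      assume "z \<ge> max J J' \<and> z' \<ge> max J J'"
      moreover have "q dvd z' - z" using d unfolding p(1) by (rule dvd_mult_left)
      ultimately show ?thesis
        using eventually_periodic_cong[of J "\<lambda>m. walk W c m e" q z z'] q z by auto
    next
      assume "z \<le> - max J J' \<and> z' \<le> - max J J'"
      moreover have "q' dvd z' - z" using d unfolding p(1) by (rule dvd_mult_right)
      then have "q' dvd - z' - - z" by (simp add: dvd_diff_commute)
      ultimately have "walk ?V c (-z) e = walk ?V c (-z') e"
        using eventually_periodic_cong[of J' "\<lambda>m. walk ?V c m e" q' "-z" "-z'"] q' by auto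
      then show ?thesis using z by (simp add: walk_uminus_iff)
    qed
  qed
  then show ?thesis using p(2) by blast
qed

section \<open>Models determined by thresholds\<close>

text \<open>There are no box rules: what boxes contribute is put into \<open>S\<close>. Clauses
  without head derive nothing and enter only through the test whether the result is a model. The
  restriction to \<open>F\<close> confines the next rules to finitely many concepts in the
  applications.\<close>

inductive closure :: "ontology \<Rightarrow> tconcept set \<Rightarrow> (tconcept \<times> int) set \<Rightarrow> tconcept \<Rightarrow> int \<Rightarrow> bool"
  for Onto F S where
  source: "(c, n) \<in> S \<Longrightarrow> closure Onto F S c n"
| clause: "Clause bs [d] \<in> Onto \<Longrightarrow> (\<And>c. c \<in> set bs \<Longrightarrow> closure Onto F S c n) \<Longrightarrow> closure Onto F S d n"
| next_F_elim: "TOp NextF c \<in> F \<Longrightarrow> closure Onto F S (TOp NextF c) n \<Longrightarrow> closure Onto F S c (n + 1)"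
| next_F_intro: "TOp NextF c \<in> F \<Longrightarrow> closure Onto F S c (n + 1) \<Longrightarrow> closure Onto F S (TOp NextF c) n"
| next_P_elim: "TOp NextP c \<in> F \<Longrightarrow> closure Onto F S (TOp NextP c) n \<Longrightarrow> closure Onto F S c (n - 1)"
| next_P_intro: "TOp NextP c \<in> F \<Longrightarrow> closure Onto F S c (n - 1) \<Longrightarrow> closure Onto F S (TOp NextP c) n"

text \<open>The first component of \<open>g\<close> lists the boxed concepts whose extension is a ray bounded by \<open>t\<close>, the
  second one those true everywhere.\<close>

definition rays :: "tconcept set \<Rightarrow> tconcept set \<times> tconcept set \<Rightarrow> (tconcept \<Rightarrow> int) \<Rightarrow> tconcept \<Rightarrow> int set" where
  "rays F g t b = {n. b \<in> F \<and> (b \<in> snd g \<or> b \<in> fst g \<and> (if \<exists>C. b = TOp BoxF C then t b \<le> n else n \<le> t b))}"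

text \<open>The last two disjuncts are box elimination: \<open>dia_P\<close> of a future ray
  collects all points later than some member of the ray, and dually for the past.\<close>

definition sources ::
  "tconcept set \<Rightarrow> tconcept set \<times> tconcept set \<Rightarrow> data \<Rightarrow> (tconcept \<Rightarrow> int) \<Rightarrow> (tconcept \<times> int) set" where
  "sources F g A t = {(c, n). (\<exists>a. c = TAtom a \<and> (a, n) \<in> A) \<or>
     (\<exists>C. c = TOp BoxF C \<or> c = TOp BoxP C) \<and> n \<in> rays F g t c \<or>
     n \<in> dia_P (rays F g t (TOp BoxF c)) \<or> n \<in> dia_F (rays F g t (TOp BoxP c))}"

definition threshold_interp ::
  "ontology \<Rightarrow> tconcept set \<Rightarrow> tconcept set \<times> tconcept set \<Rightarrow> data \<Rightarrow> (tconcept \<Rightarrow> int) \<Rightarrow> interp" where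
  "threshold_interp Onto F g A t a = {n. closure Onto F (sources F g A t) (TAtom a) n}"

definition horn_over :: "tconcept set \<Rightarrow> ontology \<Rightarrow> bool" where
  "horn_over F Onto \<longleftrightarrow> (\<forall>f C. TOp f C \<in> F \<longrightarrow> C \<in> F) \<and>
     (\<forall>cl\<in>Onto. set (body cl) \<union> set (head cl) \<subseteq> F \<and> length (head cl) \<le> 1)"

lemma up_set_cases:
  fixes X :: "int set"
  assumes "\<And>m n. m \<in> X \<Longrightarrow> m \<le> n \<Longrightarrow> n \<in> X"
  shows "X = {} \<or> X = UNIV \<or> (\<exists>t. X = {n. t \<le> n})"
proof (rule ccontr)
  assume *: "\<not> ?thesis"
  then obtain a b where a: "a \<in> X" and b: "b \<notin> X" by blast
  have ab: "b < a" using assms[OF a, of b] b by force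
  \<comment> \<open>Counting upward from the outside point \<open>b\<close> turns the least element
    of \<open>X\<close> into a minimum over the naturals.\<close>
  define k where "k = (LEAST k. b + int k \<in> X)"
  have ex: "b + int (nat (a - b)) \<in> X" using a ab by simp
  have k: "b + int k \<in> X" unfolding k_def using LeastI[of "\<lambda>k. b + int k \<in> X", OF ex] .
  have "b + int k \<le> n" if n: "n \<in> X" for n
  proof -
    have "b \<le> n" using assms[OF n, of b] b by force
    then have "k \<le> nat (n - b)" unfolding k_def using n by (intro Least_le) simp
    then show ?thesis using \<open>b \<le> n\<close> by linarith
  qed
  then have "X = {n. b + int k \<le> n}" using assms[OF k] by blast
  then show False using * by blast
qed

lemma down_set_cases:
  fixes X :: "int set"
  assumes "\<And>m n. m \<in> X \<Longrightarrow> n \<le> m \<Longrightarrow> n \<in> X"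
  shows "X = {} \<or> X = UNIV \<or> (\<exists>t. X = {n. n \<le> t})"
proof -
  have "uminus ` X = {} \<or> uminus ` X = UNIV \<or> (\<exists>t. uminus ` X = {n. t \<le> n})"
  proof (rule up_set_cases)
    fix m n assume "m \<in> uminus ` X" "m \<le> n"
    then have "- n \<in> X" using assms[of "- m" "- n"] by auto
    then show "n \<in> uminus ` X" by (rule rev_image_eqI) simp
  qed
  then consider "X = {}" | "uminus ` X = UNIV" | t where "uminus ` X = {n. t \<le> n}" by blast
  then show ?thesis
  proof cases
    case 2
    then have "uminus ` uminus ` X = (UNIV :: int set)" by (metis surj_uminus)
    then show ?thesis by (simp add: image_image)
  next
    case 3
    have "X = {n. n \<le> - t}"
    proof (intro set_eqI)
      fix n
      have "n \<in> X \<longleftrightarrow> - n \<in> uminus ` X" by force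
      then show "n \<in> X \<longleftrightarrow> n \<in> {n. n \<le> - t}" unfolding 3 by auto
    qed
    then show ?thesis by blast
  qed simp
qed

lemma rays_exist:
  "\<exists>g t. \<forall>C. (TOp BoxF C \<in> F \<longrightarrow> rays F g t (TOp BoxF C) = box_F (tc_ext M C)) \<and>
     (TOp BoxP C \<in> F \<longrightarrow> rays F g t (TOp BoxP C) = box_P (tc_ext M C))"
proof -
  \<comment> \<open>\<open>U\<close> also contains the concepts true everywhere. No ray matches
    these and \<open>t\<close> is arbitrary on them, but membership in \<open>W\<close> overrides
    it.\<close>
  define U W where "U = {b. tc_ext M b \<noteq> {}}" and "W = {b. tc_ext M b = UNIV}"
  define t where "t b = (SOME t. tc_ext M b = (if \<exists>C. b = TOp BoxF C then {n. t \<le> n} else {n. n \<le> t}))" for b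
  have "rays F (U, W) t (TOp BoxF C) = box_F (tc_ext M C)" if "TOp BoxF C \<in> F" for C
  proof -
    have "box_F (tc_ext M C) = {} \<or> box_F (tc_ext M C) = UNIV \<or> (\<exists>t. box_F (tc_ext M C) = {n. t \<le> n})"
      by (rule up_set_cases) (auto simp: box_F_def)
    moreover have "box_F (tc_ext M C) = {n. t (TOp BoxF C) \<le> n}" if "\<exists>t. box_F (tc_ext M C) = {n. t \<le> n}"
      using someI_ex[OF that] by (simp add: t_def)
    ultimately show ?thesis using that by (auto simp: rays_def U_def W_def)
  qed
  moreover have "rays F (U, W) t (TOp BoxP C) = box_P (tc_ext M C)" if "TOp BoxP C \<in> F" for C
  proof -
    have "box_P (tc_ext M C) = {} \<or> box_P (tc_ext M C) = UNIV \<or> (\<exists>t. box_P (tc_ext M C) = {n. n \<le> t})"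
      by (rule down_set_cases) (auto simp: box_P_def)
    moreover have "box_P (tc_ext M C) = {n. n \<le> t (TOp BoxP C)}" if "\<exists>t. box_P (tc_ext M C) = {n. n \<le> t}"
      using someI_ex[OF that] by (simp add: t_def)
    ultimately show ?thesis using that by (auto simp: rays_def U_def W_def)
  qed
  ultimately show ?thesis by blast
qed

text \<open>The witnesses are the thresholds of \<open>M\<close> itself. A boxed concept true in the smaller interpretation
  is true in \<open>M\<close>, hence a source; this replaces the infinitary rule of box introduction.\<close>

lemma threshold_submodel:
  assumes horn: "horn_over F Onto" and M: "is_model M Onto A"
  shows "\<exists>g t. is_model (threshold_interp Onto F g A t) Onto A \<and> (\<forall>a. threshold_interp Onto F g A t a \<subseteq> M a)"
proof -
  obtain g t where raysF: "\<And>C. TOp BoxF C \<in> F \<Longrightarrow> rays F g t (TOp BoxF C) = box_F (tc_ext M C)"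
    and raysP: "\<And>C. TOp BoxP C \<in> F \<Longrightarrow> rays F g t (TOp BoxP C) = box_P (tc_ext M C)"
    using rays_exist[of F M] by blast
  have rays_F: "b \<in> F" if "n \<in> rays F g t b" for n b using that by (simp add: rays_def)
  define S where "S = sources F g A t"
  define N where "N = threshold_interp Onto F g A t"
  have sub: "C \<in> F" if "TOp f C \<in> F" for f C using that horn by (auto simp: horn_over_def)
  have sound: "n \<in> tc_ext M c" if "closure Onto F S c n" for c n
    using that
  proof (induction rule: closure.induct)
    case (source c n)
    then consider (data) a where "c = TAtom a" "(a, n) \<in> A"
      | (box) C where "c = TOp BoxF C \<or> c = TOp BoxP C" "n \<in> rays F g t c"
      | (F) m where "m < n" "m \<in> rays F g t (TOp BoxF c)"
      | (P) m where "n < m" "m \<in> rays F g t (TOp BoxP c)"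
      by (auto simp: S_def sources_def dia_F_def dia_P_def)
    then show ?case
    proof cases
      case data
      then show ?thesis using M by (auto simp: is_model_def)
    next
      case box
      then show ?thesis using rays_F[OF box(2)] raysF raysP by auto
    next
      case F
      then show ?thesis using raysF[OF rays_F[OF F(2)]] by (auto simp: box_F_def)
    next
      case P
      then show ?thesis using raysP[OF rays_F[OF P(2)]] by (auto simp: box_P_def)
    qed
  next
    case (clause bs d n)
    have "clause_true M (Clause bs [d])" using clause.hyps(1) M by (auto simp: is_model_def)
    then show ?case using clause.IH by (auto simp: clause_true_def)
  qed (auto simp: next_F_def next_P_def)
  have complete: "tc_ext N c = {n. closure Onto F S c n}" if "c \<in> F" for c
    using that
  proof (induction c)
    case (TAtom a)
    then show ?case by (simp add: N_def S_def threshold_interp_def)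
  next
    case (TOp f C)
    then have IH: "tc_ext N C = {n. closure Onto F S C n}" using sub by blast
    show ?case
    proof (cases f)
      case BoxF
      have "closure Onto F S (TOp f C) n \<longleftrightarrow> n \<in> box_F (tc_ext N C)" for n
      proof
        \<comment> \<open>The boxed concept may have been derived by a clause rather than taken as a
          source. Soundness puts it into \<open>M\<close>, hence into its ray, and then its
          consequences are sources.\<close>
        assume "closure Onto F S (TOp f C) n"
        then have n: "n \<in> rays F g t (TOp BoxF C)" using sound[of "TOp f C" n] raysF TOp.prems BoxF by simp
        have "closure Onto F S C k" if "k > n" for k
          using n that by (intro closure.source) (auto simp: S_def sources_def dia_P_def)
        then show "n \<in> box_F (tc_ext N C)" by (auto simp: IH box_F_def)
      next
        assume "n \<in> box_F (tc_ext N C)"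
        then have "n \<in> box_F (tc_ext M C)" using sound by (auto simp: IH box_F_def)
        then have "n \<in> rays F g t (TOp f C)" using raysF TOp.prems BoxF by simp
        then show "closure Onto F S (TOp f C) n"
          using BoxF by (intro closure.source) (auto simp: S_def sources_def)
      qed
      then show ?thesis using BoxF by auto
    next
      case BoxP
      have "closure Onto F S (TOp f C) n \<longleftrightarrow> n \<in> box_P (tc_ext N C)" for n
      proof
        assume "closure Onto F S (TOp f C) n"
        then have n: "n \<in> rays F g t (TOp BoxP C)" using sound[of "TOp f C" n] raysP TOp.prems BoxP by simp
        have "closure Onto F S C k" if "k < n" for k
          using n that by (intro closure.source) (auto simp: S_def sources_def dia_F_def)
        then show "n \<in> box_P (tc_ext N C)" by (auto simp: IH box_P_def)
      next
        assume "n \<in> box_P (tc_ext N C)"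
        then have "n \<in> box_P (tc_ext M C)" using sound by (auto simp: IH box_P_def)
        then have "n \<in> rays F g t (TOp f C)" using raysP TOp.prems BoxP by simp
        then show "closure Onto F S (TOp f C) n"
          using BoxP by (intro closure.source) (auto simp: S_def sources_def)
      qed
      then show ?thesis using BoxP by auto
    next
      case NextF
      then show ?thesis
        using TOp.prems next_F_elim[of C F Onto S] next_F_intro[of C F Onto S] by (auto simp: IH next_F_def)
    next
      case NextP
      then show ?thesis
        using TOp.prems next_P_elim[of C F Onto S] next_P_intro[of C F Onto S] by (auto simp: IH next_P_def)
    qed
  qed
  have "clause_true N cl" if cl: "cl \<in> Onto" for cl
  proof -
    have F: "set (body cl) \<subseteq> F" "set (head cl) \<subseteq> F" "length (head cl) \<le> 1"
      using cl horn by (auto simp: horn_over_def)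
    have "n \<in> (\<Union>C\<in>set (head cl). tc_ext N C)" if "\<And>C. C \<in> set (body cl) \<Longrightarrow> n \<in> tc_ext N C" for n
    proof -
      have body: "closure Onto F S C n" if "C \<in> set (body cl)" for C
        using that \<open>C \<in> set (body cl) \<Longrightarrow> n \<in> tc_ext N C\<close> complete F(1) by auto
      show ?thesis
      proof (cases "head cl")
        \<comment> \<open>A body derived here would hold in \<open>M\<close> too, contradicting that
          \<open>M\<close> satisfies the headless clause.\<close>
        case Nil
        have "clause_true M cl" using cl M by (auto simp: is_model_def)
        then show ?thesis using body[THEN sound] Nil by (auto simp: clause_true_def)
      next
        case (Cons d ds)
        then have cl_eq: "cl = Clause (body cl) [d]" using F(3) by (cases cl) simp
        then have "closure Onto F S d n" using cl body by (metis closure.clause)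
        then show ?thesis using complete[of d] F(2) Cons by auto
      qed
    qed
    then show ?thesis unfolding clause_true_def by blast
  qed
  moreover have "l \<in> N a" if "(a, l) \<in> A" for a l
    using that unfolding N_def threshold_interp_def by (auto intro!: closure.source simp: sources_def)
  ultimately have "is_model N Onto A" by (auto simp: is_model_def)
  moreover have "N a \<subseteq> M a" for a
    using sound[of "TAtom a"] by (auto simp: N_def S_def threshold_interp_def)
  ultimately show ?thesis unfolding N_def by blast
qed

lemma pext_mono: "(\<And>a. M a \<subseteq> N a) \<Longrightarrow> pext M k \<subseteq> pext N k"
proof (induction k)
  case (PUntil k1 k2)
  then have "pext M k1 \<subseteq> pext N k1" "pext M k2 \<subseteq> pext N k2" by blast+
  then show ?case unfolding pext.simps until_def by blast
next
  case (PSince k1 k2)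
  then have "pext M k1 \<subseteq> pext N k1" "pext M k2 \<subseteq> pext N k2" by blast+
  then show ?case unfolding pext.simps since_def by blast
qed (auto simp: next_F_def next_P_def box_F_def box_P_def dia_F_def dia_P_def; blast)+

text \<open>This trades quantification over arbitrary models for quantification over finitely many
  integers, once \<open>F\<close> is finite: every model lies above a threshold model, and positive
  concepts are monotone.\<close>

lemma ans_iff_threshold_models:
  assumes "horn_over F Onto"
  shows "l \<in> ans (Onto, \<kappa>) A \<longleftrightarrow> l \<in> tem A \<and>
    (\<forall>g t. is_model (threshold_interp Onto F g A t) Onto A \<longrightarrow> l \<in> pext (threshold_interp Onto F g A t) \<kappa>)"
proof -
  have "l \<in> pext M \<kappa>" if M: "is_model M Onto A"
    and all: "\<forall>g t. is_model (threshold_interp Onto F g A t) Onto A \<longrightarrow> l \<in> pext (threshold_interp Onto F g A t) \<kappa>" for M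
  proof -
    obtain g t where gt: "is_model (threshold_interp Onto F g A t) Onto A" "\<And>a. threshold_interp Onto F g A t a \<subseteq> M a"
      using threshold_submodel[OF assms M] by blast
    then have "l \<in> pext (threshold_interp Onto F g A t) \<kappa>" using all by blast
    then show ?thesis using pext_mono[of "threshold_interp Onto F g A t" M \<kappa>] gt(2) by blast
  qed
  then show ?thesis unfolding ans_def by auto
qed

section \<open>Rewritability\<close>

context invariance
begin

lemma invariant_tc_ext:
  assumes "\<And>a. TAtom a \<in> F \<Longrightarrow> invariant (\<lambda>g A t. N g A t a)" "\<And>f C. TOp f C \<in> F \<Longrightarrow> C \<in> F" "c \<in> F"
  shows "invariant (\<lambda>g A t. tc_ext (N g A t) c)"
  using assms(3)
proof (induction c)
  case (TOp f C)
  then show ?case using assms(2) by (simp add: invariant_tempop)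
qed (simp add: assms(1))

end

primrec patoms :: "pconcept \<Rightarrow> atom set" where
  "patoms PTop = {}"
| "patoms (PAtom a) = {a}"
| "patoms (PAnd c d) = patoms c \<union> patoms d"
| "patoms (POr c d) = patoms c \<union> patoms d"
| "patoms (PNextF c) = patoms c"
| "patoms (PDiaF c) = patoms c"
| "patoms (PBoxF c) = patoms c"
| "patoms (PUntil c d) = patoms c \<union> patoms d"
| "patoms (PNextP c) = patoms c"
| "patoms (PDiaP c) = patoms c"
| "patoms (PBoxP c) = patoms c"
| "patoms (PSince c d) = patoms c \<union> patoms d"

lemma (in invariance) invariant_pext:
  assumes "\<And>a. a \<in> patoms \<kappa> \<Longrightarrow> invariant (\<lambda>g A t. N g A t a)"
  shows "invariant (\<lambda>g A t. pext (N g A t) \<kappa>)"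
  using assms
  by (induction \<kappa>)
    (simp_all add: invariant_UNIV invariant_Int invariant_Un invariant_temporal invariant_until invariant_since)

locale concept_invariance = invariance \<Sigma> p F for \<Sigma> p and F :: "tconcept set"
begin

lemma invariant_rays_family: "invariant (\<lambda>g A t. rays F g t b)"
proof (cases "b \<in> F")
  case False
  then show ?thesis by (simp add: rays_def invariant_empty)
next
  case True
  have eq: "(\<lambda>g A t. rays F g t b) = (\<lambda>g A t. {x. b \<in> snd g} \<union> {x. b \<in> fst g} \<inter>
    (if \<exists>C. b = TOp BoxF C then {x. t b \<le> x} else {x. x \<le> t b}))"
    using True by (intro ext) (auto simp: rays_def)
  have "invariant (\<lambda>g A t. if \<exists>C. b = TOp BoxF C then {x. t b \<le> x} else {x. x \<le> t b})"
    using invariant_rays[of b] True by (cases "\<exists>C. b = TOp BoxF C") simp_all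
  then show ?thesis unfolding eq by (intro invariant_Un invariant_Int invariant_const)
qed

lemma invariant_sources:
  assumes "\<And>a. c = TAtom a \<Longrightarrow> a \<in> \<Sigma>"
  shows "invariant (\<lambda>g A t. {n. (c, n) \<in> sources F g A t})"
proof -
  have data: "invariant (\<lambda>g A t. {n. \<exists>a. c = TAtom a \<and> (a, n) \<in> A})"
    using assms by (cases c) (simp_all add: invariant_data invariant_empty)
  have eq: "(\<lambda>g A t. {n. (c, n) \<in> sources F g A t}) = (\<lambda>g A t. {n. \<exists>a. c = TAtom a \<and> (a, n) \<in> A} \<union>
      ({n. \<exists>C. c = TOp BoxF C \<or> c = TOp BoxP C} \<inter> rays F g t c \<union>
      (dia_P (rays F g t (TOp BoxF c)) \<union> dia_F (rays F g t (TOp BoxP c)))))"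
    by (intro ext) (auto simp: sources_def)
  show ?thesis
    unfolding eq
    by (intro invariant_Un invariant_Int invariant_const invariant_temporal data invariant_rays_family)
qed

end

lemma rewritable_if_closure_invariant:
  assumes horn: "horn_over F Onto" and fin: "finite Onto" "finite F" and "p > 0"
    and \<kappa>: "\<And>a. a \<in> patoms \<kappa> \<Longrightarrow> TAtom a \<in> F"
    and inv: "\<And>c. c \<in> F \<Longrightarrow> invariance.invariant {a. TAtom a \<in> F} p F
      (\<lambda>g A t. {n. closure Onto F (sources F g A t) c n})"
  shows "rewritable {f. moduli f \<subseteq> {p} - {1}} (Onto, \<kappa>)"
proof -
  define \<Sigma> where "\<Sigma> = {a. TAtom a \<in> F}"
  have "finite \<Sigma>" unfolding \<Sigma>_def using finite_vimageI[OF fin(2), of TAtom] by (simp add: inj_def vimage_def)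
  interpret invariance \<Sigma> p F .
  let ?N = "threshold_interp Onto F"
  have N: "invariant (\<lambda>g A t. ?N g A t a)" if "TAtom a \<in> F" for a
    unfolding threshold_interp_def \<Sigma>_def by (rule inv[OF that])
  \<comment> \<open>The points at which some clause fails. Being a model is emptiness of this set,
    so it costs one more round than the set itself.\<close>
  define bad where "bad = (\<lambda>g A t. \<Union>cl\<in>Onto. (\<Inter>C\<in>set (body cl). tc_ext (?N g A t) C) \<inter>
    - (\<Union>C\<in>set (head cl). tc_ext (?N g A t) C))"
  have tc: "invariant (\<lambda>g A t. tc_ext (?N g A t) C)" if "C \<in> F" for C
    by (rule invariant_tc_ext[OF N _ that]) (use horn in \<open>auto simp: horn_over_def\<close>)
  have "invariant bad"
    unfolding bad_def
    by (intro invariant_UN invariant_Int invariant_INT invariant_Compl tc fin(1) finite_set)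
      (use horn in \<open>auto simp: horn_over_def\<close>)
  moreover have "invariant (\<lambda>g A t. pext (?N g A t) \<kappa>)"
    by (rule invariant_pext[OF N[OF \<kappa>]])
  ultimately obtain k where k: "preserved k bad" "preserved k (\<lambda>g A t. pext (?N g A t) \<kappa>)"
    by (rule preserved2)
  have model: "is_model (?N g A t) Onto A \<longleftrightarrow> bad g A t = {}" for g A t
  proof -
    have "l \<in> ?N g A t a" if "(a, l) \<in> A" for a l
      using that unfolding threshold_interp_def by (auto intro!: closure.source simp: sources_def)
    then have "is_model (?N g A t) Onto A \<longleftrightarrow> (\<forall>cl\<in>Onto. clause_true (?N g A t) cl)"
      by (auto simp: is_model_def)
    then show ?thesis unfolding clause_true_def bad_def by blast
  qed
  show ?thesis
  proof (rule rewritable_if_invariant[OF \<open>finite \<Sigma>\<close> \<open>p > 0\<close>])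
    fix A A' x x'
    assume A: "data_instance A" "data_instance A'" "x \<in> tem A" "x' \<in> tem A'" "x \<in> ans (Onto, \<kappa>) A"
      and bf0: "back_forth (tem A) (tem A') \<Sigma> p A A' (Suc k + card F + 3) {(x, x')}"
    \<comment> \<open>Rank budget: three rounds for the passage to the line, \<open>card F\<close>
      for the thresholds, one for a point violating a clause, and \<open>k\<close> for
      \<open>bad\<close> and the query.\<close>
    note bf = back_forth_tem_to_bfZ[OF A(1-4) bf0]
    have "x' \<in> pext (?N g A' t') \<kappa>" if m: "is_model (?N g A' t') Onto A'" for g t'
    proof -
      \<comment> \<open>For a guess \<open>g\<close>, \<open>t'\<close> over \<open>A'\<close> the
        strategy supplies \<open>t\<close> over \<open>A\<close> with the same \<open>g\<close>;
        both closures are models or neither is.\<close>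
      define R where "R t = {(x, x')} \<union> (\<lambda>b. (t b, t' b)) ` F" for t
      obtain t where t: "bfZ \<Sigma> p A A' (Suc k) (R t)"
        using bfZ_back_params[OF fin(2) bf, of t'] unfolding R_def by (rule exE)
      have Rt: "\<forall>b\<in>F. (t b, t' b) \<in> R t" "(x, x') \<in> R t" by (auto simp: R_def)
      have "n \<notin> bad g A t" for n
      proof -
        obtain n' where n': "bfZ \<Sigma> p A A' k (insert (n, n') (R t))" using bfZ_forth[OF t] .
        have "n \<in> bad g A t \<longleftrightarrow> n' \<in> bad g A' t'"
          using preservedD[OF k(1) n' order_refl, of t t' n n' g] Rt(1) by (simp del: back_forth.simps)
        then show ?thesis using m model by simp
      qed
      then have "is_model (?N g A t) Onto A" using model by blast
      then have "x \<in> pext (?N g A t) \<kappa>" using A(5) ans_iff_threshold_models[OF horn] by blast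
      moreover have "x \<in> pext (?N g A t) \<kappa> \<longleftrightarrow> x' \<in> pext (?N g A' t') \<kappa>"
        using preservedD[OF k(2) t _ Rt] by simp
      ultimately show ?thesis by blast
    qed
    then show "x' \<in> ans (Onto, \<kappa>) A'" using A(4) ans_iff_threshold_models[OF horn] by blast
  qed
qed

section \<open>Relevant concepts and the closure in the two fragments\<close>

primrec subconcepts :: "tconcept \<Rightarrow> tconcept set" where
  "subconcepts (TAtom a) = {TAtom a}"
| "subconcepts (TOp f C) = insert (TOp f C) (subconcepts C)"

lemma subconcepts_refl: "C \<in> subconcepts C"
  by (cases C) auto

lemma subconcepts_TOp: "TOp f C \<in> subconcepts D \<Longrightarrow> C \<in> subconcepts D \<and> f \<in> tops D"
  by (induction D) (auto simp: subconcepts_refl)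

lemma finite_subconcepts: "finite (subconcepts C)"
  by (induction C) auto

text \<open>The query's atoms are added so that the games see the data about them even when the
  ontology does not mention them.\<close>

definition query_concepts :: "ontology \<Rightarrow> pconcept \<Rightarrow> tconcept set" where
  "query_concepts Onto \<kappa> =
     (\<Union>cl\<in>Onto. \<Union>C\<in>set (body cl) \<union> set (head cl). subconcepts C) \<union> TAtom ` patoms \<kappa>"

lemma finite_query_concepts:
  assumes "finite Onto" shows "finite (query_concepts Onto \<kappa>)"
proof -
  have "finite (patoms \<kappa>)" by (induction \<kappa>) auto
  then show ?thesis using assms by (simp add: query_concepts_def finite_subconcepts)
qed

lemma query_concepts_TOp:
  assumes "TOp f C \<in> query_concepts Onto \<kappa>"
  shows "C \<in> query_concepts Onto \<kappa> \<and> (\<exists>cl\<in>Onto. f \<in> clause_tops cl)"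
proof -
  obtain cl D where "cl \<in> Onto" "D \<in> set (body cl) \<union> set (head cl)" "TOp f C \<in> subconcepts D"
    using assms by (auto simp: query_concepts_def)
  then show ?thesis using subconcepts_TOp[of f C D] unfolding query_concepts_def clause_tops_def by blast
qed

lemma horn_over_query_concepts:
  assumes "\<And>cl. cl \<in> Onto \<Longrightarrow> length (head cl) \<le> 1"
  shows "horn_over (query_concepts Onto \<kappa>) Onto"
  unfolding horn_over_def
proof (intro conjI allI impI ballI)
  show "set (body cl) \<union> set (head cl) \<subseteq> query_concepts Onto \<kappa>" if "cl \<in> Onto" for cl
    using that subconcepts_refl unfolding query_concepts_def by blast
qed (use assms query_concepts_TOp in blast)+

text \<open>Without next operators no rule moves along the line.\<close>

lemma closure_local:
  assumes "closure Onto F S c n" "c \<in> F" "horn_over F Onto"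
    and "\<And>C. TOp NextF C \<notin> F \<and> TOp NextP C \<notin> F"
    and "\<And>d. d \<in> F \<Longrightarrow> (d, n) \<in> S \<Longrightarrow> (d, n') \<in> S'"
  shows "closure Onto F S' c n'"
  using assms(1,2,5)
proof (induction rule: closure.induct)
  case (source c n)
  then show ?case by (auto intro: closure.source)
next
  case (clause bs d n)
  then have "set bs \<subseteq> F" using assms(3) unfolding horn_over_def by fastforce
  then show ?case using clause by (intro closure.clause[of bs d]) auto
qed (use assms(4) in auto)

text \<open>One edge per rule with a single premise, weighted by its shift along the line. Next
  rules come in opposite pairs; clauses do not move.\<close>

definition core_edges :: "ontology \<Rightarrow> tconcept set \<Rightarrow> (tconcept \<times> int \<times> tconcept) set" where
  "core_edges Onto F = {(c, 0, d) |c d. Clause [c] [d] \<in> Onto} \<union>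
     {(TOp NextF c, 1, c) |c. TOp NextF c \<in> F} \<union> {(c, -1, TOp NextF c) |c. TOp NextF c \<in> F} \<union>
     {(TOp NextP c, -1, c) |c. TOp NextP c \<in> F} \<union> {(c, 1, TOp NextP c) |c. TOp NextP c \<in> F}"

lemma closure_walk:
  assumes "walk (core_edges Onto F) d z c" "closure Onto F S d m"
  shows "closure Onto F S c (m + z)"
  using assms
proof (induction rule: walk.induct)
  case (walk_step d z c w e)
  then have c: "closure Onto F S c (m + z)" by blast
  from walk_step.hyps(2) show ?case
    unfolding core_edges_def
    using closure.clause[of "[c]" e Onto F S "m + z"] closure.next_F_elim[of e F Onto S "m + z"]
      closure.next_F_intro[of c F Onto S "m + z - 1"] closure.next_P_elim[of e F Onto S "m + z"]
      closure.next_P_intro[of c F Onto S "m + z + 1"] c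
    by (auto simp: algebra_simps)
qed simp

text \<open>A core clause with a head has at most one premise, so a derivation is a path. It starts
  at a source or at a clause with empty body, which holds at every \<open>m\<close>.\<close>

lemma closure_core:
  assumes core: "\<And>cl. cl \<in> Onto \<Longrightarrow> length (body cl) + length (head cl) \<le> 2"
  shows "closure Onto F S c n \<longleftrightarrow>
    (\<exists>d m. ((d, m) \<in> S \<or> Clause [] [d] \<in> Onto) \<and> walk (core_edges Onto F) d (n - m) c)"
proof
  assume "closure Onto F S c n"
  then show "\<exists>d m. ((d, m) \<in> S \<or> Clause [] [d] \<in> Onto) \<and> walk (core_edges Onto F) d (n - m) c"
  proof (induction rule: closure.induct)
    case (source c n)
    then show ?case using walk_refl[of "core_edges Onto F" c] by (metis diff_self)
  next
    case (clause bs d n)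
    show ?case
    proof (cases bs)
      case Nil
      then show ?thesis using clause.hyps walk_refl[of "core_edges Onto F" d] by (metis diff_self)
    next
      case (Cons b bs')
      then have bs: "bs = [b]" using core[OF clause.hyps(1)] by simp
      then have "(b, 0, d) \<in> core_edges Onto F" using clause.hyps(1) by (simp add: core_edges_def)
      then show ?thesis using clause.IH[of b] bs walk_step[of "core_edges Onto F" _ _ b 0 d] by fastforce
    qed
  next
    case (next_F_elim c n)
    then have "(TOp NextF c, 1, c) \<in> core_edges Onto F" by (simp add: core_edges_def)
    from walk_step[OF _ this] next_F_elim.IH show ?case by (metis add_diff_eq diff_add_eq)
  next
    case (next_F_intro c n)
    then have "(c, -1, TOp NextF c) \<in> core_edges Onto F" by (simp add: core_edges_def)
    moreover have "n + 1 - m + -1 = n - m" for m by simp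
    ultimately show ?case using walk_step[of "core_edges Onto F" _ _ c "-1" "TOp NextF c"] next_F_intro.IH by metis
  next
    case (next_P_elim c n)
    then have "(TOp NextP c, -1, c) \<in> core_edges Onto F" by (simp add: core_edges_def)
    moreover have "n - m + -1 = n - 1 - m" for m by simp
    ultimately show ?case using walk_step[of "core_edges Onto F" _ _ "TOp NextP c" "-1" c] next_P_elim.IH by metis
  next
    case (next_P_intro c n)
    then have "(c, 1, TOp NextP c) \<in> core_edges Onto F" by (simp add: core_edges_def)
    moreover have "n - 1 - m + 1 = n - m" for m by simp
    ultimately show ?case using walk_step[of "core_edges Onto F" _ _ c 1 "TOp NextP c"] next_P_intro.IH by metis
  qed
next
  assume "\<exists>d m. ((d, m) \<in> S \<or> Clause [] [d] \<in> Onto) \<and> walk (core_edges Onto F) d (n - m) c"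
  then obtain d m where d: "(d, m) \<in> S \<or> Clause [] [d] \<in> Onto" "walk (core_edges Onto F) d (n - m) c" by blast
  from d(1) have "closure Onto F S d m" by (auto intro: closure.source closure.clause[of "[]"])
  then show "closure Onto F S c n" using closure_walk[OF d(2)] by fastforce
qed

section \<open>Rewritability of the two fragments\<close>

lemma rewritable_box_horn:
  assumes "ltl_box_horn Onto"
  shows "rewritable FO_less (Onto, \<kappa>)"
proof -
  define F where "F = query_concepts Onto \<kappa>"
  have horn: "horn_over F Onto"
    unfolding F_def using assms by (intro horn_over_query_concepts) (auto simp: ltl_box_horn_def)
  have fin: "finite Onto" "finite F" using assms by (auto simp: F_def ltl_box_horn_def finite_query_concepts)
  have no_next: "TOp NextF C \<notin> F \<and> TOp NextP C \<notin> F" for C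
    using assms query_concepts_TOp[of NextF C Onto \<kappa>] query_concepts_TOp[of NextP C Onto \<kappa>]
    unfolding F_def ltl_box_horn_def by blast
  interpret concept_invariance "{a. TAtom a \<in> F}" 1 F .
  have src: "invariant (\<lambda>g A t. {n. (d, n) \<in> sources F g A t})" if "d \<in> F" for d
    using that by (intro invariant_sources) simp
  obtain k where k: "\<And>d. d \<in> F \<Longrightarrow> preserved k (\<lambda>g A t. {n. (d, n) \<in> sources F g A t})"
    using preserved_family[of F "\<lambda>d g A t. {n. (d, n) \<in> sources F g A t}"] fin(2) src by blast
  have "rewritable {f. moduli f \<subseteq> {1} - {1}} (Onto, \<kappa>)"
  proof (rule rewritable_if_closure_invariant[OF horn fin])
    show "TAtom a \<in> F" if "a \<in> patoms \<kappa>" for a using that by (simp add: F_def query_concepts_def)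
    fix c assume c: "c \<in> F"
    \<comment> \<open>Since derivations stay at one point, agreement on the sources there carries
      over the whole derivation, at no extra rank.\<close>
    have "preserved k (\<lambda>g A t. {n. closure Onto F (sources F g A t) c n})"
    proof (rule preservedI)
      fix g A A' t t' R x x'
      assume *: "bfZ {a. TAtom a \<in> F} 1 A A' k R" "\<forall>b\<in>F. (t b, t' b) \<in> R" "(x, x') \<in> R"
        and "x \<in> {n. closure Onto F (sources F g A t) c n}"
      then have x: "closure Onto F (sources F g A t) c x" by simp
      have "(d, x') \<in> sources F g A' t'" if "d \<in> F" "(d, x) \<in> sources F g A t" for d
        using preservedD[OF k[OF that(1)] *(1) order_refl *(2,3), of g] that(2) by simp
      then show "x' \<in> {n. closure Onto F (sources F g A' t') c n}"
        unfolding mem_Collect_eq by (rule closure_local[OF x c horn no_next])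
    qed
    then show "invariant (\<lambda>g A t. {n. closure Onto F (sources F g A t) c n})"
      unfolding invariant_def by blast
  qed simp
  then show ?thesis by (simp add: FO_less_def)
qed

lemma rewritable_box_next_core:
  assumes "ltl_box_next_core Onto"
  shows "rewritable FO_less_cong (Onto, \<kappa>)"
proof -
  define F where "F = query_concepts Onto \<kappa>"
  have horn: "horn_over F Onto"
    unfolding F_def using assms by (intro horn_over_query_concepts) (auto simp: ltl_box_next_core_def)
  have core: "\<And>cl. cl \<in> Onto \<Longrightarrow> length (body cl) + length (head cl) \<le> 2"
    using assms by (auto simp: ltl_box_next_core_def)
  have fin: "finite Onto" "finite F" using assms by (auto simp: F_def ltl_box_next_core_def finite_query_concepts)
  have edges: "d \<in> F \<and> e \<in> F \<and> \<bar>w\<bar> \<le> 1" if "(d, w, e) \<in> core_edges Onto F" for d w e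
    using that horn unfolding horn_over_def core_edges_def by force
  have "\<exists>p>0. \<forall>d c. ult_periodic p {z. walk (core_edges Onto F) d z c}"
    by (rule walk_ult_periodic[OF fin(2)]) (use edges in blast)+
  then obtain p where p: "p > 0" "\<And>d c. ult_periodic p {z. walk (core_edges Onto F) d z c}"
    by blast
  interpret concept_invariance "{a. TAtom a \<in> F}" p F .
  have "rewritable {f. moduli f \<subseteq> {p} - {1}} (Onto, \<kappa>)"
  proof (rule rewritable_if_closure_invariant[OF horn fin p(1)])
    show "TAtom a \<in> F" if "a \<in> patoms \<kappa>" for a using that by (simp add: F_def query_concepts_def)
    fix c assume c: "c \<in> F"
    define X where "X d g A t = {n. (d, n) \<in> sources F g A t} \<union> {n. Clause [] [d] \<in> Onto}" for d g A t
    have eq: "(\<lambda>g A t. {n. closure Onto F (sources F g A t) c n}) =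
      (\<lambda>g A t. \<Union>d\<in>F. {n. \<exists>m\<in>X d g A t. n - m \<in> {z. walk (core_edges Onto F) d z c}})"
    proof (intro ext set_eqI)
      fix g A t n
      \<comment> \<open>A walk ending in \<open>F\<close> also starts in \<open>F\<close>, which
        makes the union over starting concepts finite.\<close>
      have d: "d \<in> F" if "walk (core_edges Onto F) d z c" for d z
        using walk_cases_field[OF that, of F] edges c by blast
      have "closure Onto F (sources F g A t) c n \<longleftrightarrow>
        (\<exists>d m. ((d, m) \<in> sources F g A t \<or> Clause [] [d] \<in> Onto) \<and> walk (core_edges Onto F) d (n - m) c)"
        by (rule closure_core) (rule core)
      also have "\<dots> \<longleftrightarrow> (\<exists>d\<in>F. \<exists>m\<in>X d g A t. walk (core_edges Onto F) d (n - m) c)"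
        unfolding X_def using d by blast
      finally show "n \<in> {n. closure Onto F (sources F g A t) c n} \<longleftrightarrow>
        n \<in> (\<Union>d\<in>F. {n. \<exists>m\<in>X d g A t. n - m \<in> {z. walk (core_edges Onto F) d z c}})"
        by simp
    qed
    have "invariant (X d)" if "d \<in> F" for d
      unfolding X_def
      by (intro invariant_Un invariant_const invariant_sources) (use that in auto)
    then show "invariant (\<lambda>g A t. {n. closure Onto F (sources F g A t) c n})"
      unfolding eq by (intro invariant_UN[OF fin(2)] invariant_distance[OF _ p(2)])
  qed
  moreover have "{f. moduli f \<subseteq> {p} - {1}} \<subseteq> FO_less_cong" using p(1) by (auto simp: FO_less_cong_def)
  ultimately show ?thesis unfolding rewritable_def by blast
qed

theorem theorem24:
  shows "(\<forall>Onto \<kappa>. ltl_box_next_core Onto \<longrightarrow> rewritable FO_less_cong (Onto, \<kappa>)) \<and>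
         (\<forall>Onto \<kappa>. ltl_box_horn Onto \<longrightarrow> rewritable FO_less (Onto, \<kappa>))"
  using rewritable_box_next_core rewritable_box_horn by blast

end
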